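(* Let $G$ be a nice graph on at least $3$ vertices. Then $\mathrm{mind}(G) \leq \partial_2(G)$, and hence $\mathrm{ch}_\Sigma^e(G) \leq \partial_2(G) + 1$.
   Context: All graphs are finite, simple and loopless. A graph is nice if it has no connected component isomorphic to $K_2$. Monomial index. For a polynomial $P \in \mathbb{R}[x_1,\ldots,x_m]$ and a monomial $M$ occurring in $P$ with nonzero coefficient (after full expansion), let $h(M)$ be the largest exponent of any variable in $M$. The monomial index $\mathrm{mind}(P)$ is the minimum of $h(M)$ over all monomials $M$ of $P$ with nonzero coefficient (with $\mathrm{mind}(0)=\infty$). For a graph $G$ with edges $e_1,\ldots,e_m$, associate the variable $x_i$ with $e_i$, and for each vertex $v$ put $X_v = \sum_{e_i \ni v} x_i$. For an orientation $D$ of $G$ let $P_D(x_1,\ldots,x_m) = \prod_{(u,v)\in E(D)} (X_v - X_u)$. Define $\mathrm{mind}(G) = \mathrm{mind}(P_D)$; this does not depend on the orientation $D$, since changing $D$ changes $P_D$ only by a sign. Edge weight choosability number. $\mathrm{ch}_\Sigma^e(G)$ is the smallest positive integer $k$ such that for every assignment of a list $L_e$ of $k$ real numbers to each edge $e$ of $G$ there is a choice of weights $w(e)\in L_e$ ($e \in E(G)$) for which $v \mapsto \sum_{e\ni v} w(e)$ is a proper colouring of $V(G)$ (adjacent vertices get different sums). 2-degeneracy. For a graph $H$ having two vertices at distance exactly $2$ in $H$, let $\delta_2(H)$ be the minimum of $d_H(u)+d_H(v)$ over all pairs $u,v\in V(H)$ at distance exactly $2$ in $H$. Then $\partial_2(G)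 = \max \delta_2(H)$, the maximum taken over all induced subgraphs $H$ of $G$ that have two vertices at distance exactly $2$. If no induced subgraph of $G$ has two vertices at distance exactly $2$, then by convention $\partial_2(G) = 2\Delta(G)$, where $\Delta(G)$ is the maximum degree of $G$. *)

theory Defs
  imports Complex_Main "HOL-Library.Poly_Mapping" "HOL-Library.Extended_Nat"
begin

record 'v ugraph =
  verts :: "'v set"
  edges :: "'v set set"

definition simple_graph :: "'v ugraph \<Rightarrow> bool" where
  "simple_graph G \<longleftrightarrow> finite (verts G) \<and> (\<forall>e\<in>edges G. e \<subseteq> verts G \<and> card e = 2)"

definition induced :: "'v ugraph \<Rightarrow> 'v set \<Rightarrow> 'v ugraph" where
  "induced G W = \<lparr>verts = W, edges = {e \<in> edges G. e \<subseteq> W}\<rparr>"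

definition complete_graph :: "nat \<Rightarrow> nat ugraph" where
  "complete_graph n = \<lparr>verts = {..<n}, edges = {e. e \<subseteq> {..<n} \<and> card e = 2}\<rparr>"

definition isomorphic :: "'v ugraph \<Rightarrow> 'w ugraph \<Rightarrow> bool" where
  "isomorphic G H \<longleftrightarrow>
     (\<exists>f. bij_betw f (verts G) (verts H) \<and>
          (\<forall>u\<in>verts G. \<forall>v\<in>verts G. {u, v} \<in> edges G \<longleftrightarrow> {f u, f v} \<in> edges H))"

definition adj :: "'v ugraph \<Rightarrow> ('v \<times> 'v) set" where
  "adj G = {(u, v). {u, v} \<in> edges G}"

definition components :: "'v ugraph \<Rightarrow> 'v ugraph set" where
  "components G = {induced G ((adj G)\<^sup>* `` {v}) | v. v \<in> verts G}"

definition nice :: "'v ugraph \<Rightarrow> bool" where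
  "nice G \<longleftrightarrow> (\<forall>C\<in>components G. \<not> isomorphic C (complete_graph 2))"

definition degree :: "'v ugraph \<Rightarrow> 'v \<Rightarrow> nat" where
  "degree G v = card {e \<in> edges G. v \<in> e}"

definition max_degree :: "'v ugraph \<Rightarrow> nat" where
  "max_degree G = Max (degree G ` verts G)"

text \<open>The length of a shortest walk; \<open>\<infinity>\<close> if there is none.\<close>

definition distance :: "'v ugraph \<Rightarrow> 'v \<Rightarrow> 'v \<Rightarrow> enat" where
  "distance G u v = Inf {enat n | n. (u, v) \<in> adj G ^^ n}"


subsection \<open>2-degeneracy\<close>

definition dist2_pairs :: "'v ugraph \<Rightarrow> ('v \<times> 'v) set" where
  "dist2_pairs H = {(u, v). u \<in> verts H \<and> v \<in> verts H \<and> distance H u v = 2}"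

definition delta2 :: "'v ugraph \<Rightarrow> nat" where
  "delta2 H = Min {degree H u + degree H v | u v. (u, v) \<in> dist2_pairs H}"

definition degeneracy2 :: "'v ugraph \<Rightarrow> nat" where
  "degeneracy2 G =
     (if \<exists>W\<subseteq>verts G. dist2_pairs (induced G W) \<noteq> {}
      then Max {delta2 (induced G W) | W. W \<subseteq> verts G \<and> dist2_pairs (induced G W) \<noteq> {}}
      else 2 * max_degree G)"


subsection \<open>Monomial index\<close>

text \<open>A real polynomial in variables of type \<open>'x\<close>: monomials are finitely supported
  exponent functions, polynomials are finitely supported coefficient functions on
  monomials, and multiplication is convolution.\<close>

type_synonym 'x mpoly = "('x \<Rightarrow>\<^sub>0 nat) \<Rightarrow>\<^sub>0 real"

definition var :: "'x \<Rightarrow> 'x mpoly" where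
  "var x = Poly_Mapping.single (Poly_Mapping.single x 1) 1"

definition max_exponent :: "('x \<Rightarrow>\<^sub>0 nat) \<Rightarrow> nat" where
  "max_exponent M = Max (range (Poly_Mapping.lookup M))"

text \<open>The infimum of the empty set is \<open>\<infinity>\<close>, so the zero polynomial has index \<open>\<infinity>\<close>.\<close>

definition mind :: "'x mpoly \<Rightarrow> enat" where
  "mind P = (INF M\<in>Poly_Mapping.keys P. enat (max_exponent M))"

text \<open>The edges themselves index the variables.\<close>

definition vertex_poly :: "'v ugraph \<Rightarrow> 'v \<Rightarrow> 'v set mpoly" where
  "vertex_poly G v = (\<Sum>e\<in>{e \<in> edges G. v \<in> e}. var e)"

text \<open>Each edge is the underlying set of exactly one arc.\<close>

definition orientation :: "'v ugraph \<Rightarrow> ('v \<times> 'v) set \<Rightarrow> bool" where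
  "orientation G D \<longleftrightarrow> bij_betw (\<lambda>(u, v). {u, v}) D (edges G)"

definition orientation_poly :: "'v ugraph \<Rightarrow> ('v \<times> 'v) set \<Rightarrow> 'v set mpoly" where
  "orientation_poly G D = (\<Prod>(u, v)\<in>D. vertex_poly G v - vertex_poly G u)"

text \<open>The choice of orientation is immaterial, see \<open>graph_mind_eq\<close> below.\<close>

definition graph_mind :: "'v ugraph \<Rightarrow> enat" where
  "graph_mind G = mind (orientation_poly G (SOME D. orientation G D))"

lemma orientation_exists:
  assumes "simple_graph G"
  shows "\<exists>D. orientation G D"
proof -
  have "\<forall>e\<in>edges G. \<exists>a. (\<lambda>(u, v). {u, v}) a = e"
    using assms by (fastforce simp: simple_graph_def card_2_iff)
  then obtain f where f: "\<And>e. e \<in> edges G \<Longrightarrow> (\<lambda>(u, v). {u, v}) (f e) = e"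
    by metis
  have "bij_betw (\<lambda>(u, v). {u, v}) (f ` edges G) (edges G)"
    by (rule bij_betw_byWitness[where f' = f]) (use f in \<open>auto simp: case_prod_unfold\<close>)
  then show ?thesis by (auto simp: orientation_def)
qed

lemma orientation_poly_sign:
  assumes "orientation G D" "orientation G D'"
  shows "orientation_poly G D = orientation_poly G D' \<or>
         orientation_poly G D = - orientation_poly G D'"
proof -
  let ?s = "\<lambda>(u, v). {u, v} :: 'a set"
  let ?d = "\<lambda>(u, v). vertex_poly G v - vertex_poly G u"
  define g where "g = inv_into D ?s"
  define g' where "g' = inv_into D' ?s"
  have b: "bij_betw g (edges G) D" "bij_betw g' (edges G) D'"
    using assms by (auto simp: orientation_def g_def g'_def bij_betw_inv_into)
  have s: "?s (g e) = e" "?s (g' e) = e" if "e \<in> edges G" for e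
    using assms that unfolding orientation_def g_def g'_def
    by (auto intro!: bij_betw_inv_into_right)
  have pm: "?d (g e) = ?d (g' e) \<or> ?d (g e) = - ?d (g' e)" if "e \<in> edges G" for e
    using s[OF that] by (cases "g e"; cases "g' e") (auto simp: doubleton_eq_iff)
  have "(\<Prod>e\<in>A. ?d (g e)) = (\<Prod>e\<in>A. ?d (g' e)) \<or>
        (\<Prod>e\<in>A. ?d (g e)) = - (\<Prod>e\<in>A. ?d (g' e))" if "A \<subseteq> edges G" for A
    using that
  proof (induction A rule: infinite_finite_induct)
    case (insert e A)
    then have "?d (g e) = ?d (g' e) \<or> ?d (g e) = - ?d (g' e)" using pm by blast
    with insert show ?case by auto
  qed auto
  from this[of "edges G"] show ?thesis
    unfolding orientation_poly_def
    using prod.reindex_bij_betw[OF b(1), of ?d] prod.reindex_bij_betw[OF b(2), of ?d]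
    by simp
qed

lemma mind_uminus: "mind (- P) = mind P"
  by (simp add: mind_def)

lemma graph_mind_eq:
  assumes "orientation G D"
  shows "graph_mind G = mind (orientation_poly G D)"
  using orientation_poly_sign[OF someI[of "orientation G", OF assms] assms]
  by (auto simp: graph_mind_def mind_uminus)


subsection \<open>Edge weight choosability\<close>

definition edge_weight_choosable :: "'v ugraph \<Rightarrow> nat \<Rightarrow> bool" where
  "edge_weight_choosable G k \<longleftrightarrow>
     (\<forall>L :: 'v set \<Rightarrow> real set. (\<forall>e\<in>edges G. finite (L e) \<and> card (L e) = k) \<longrightarrow>
        (\<exists>w :: 'v set \<Rightarrow> real. (\<forall>e\<in>edges G. w e \<in> L e) \<and>
           (\<forall>u v. {u, v} \<in> edges G \<longrightarrow>
              (\<Sum>e\<in>{e \<in> edges G. u \<in> e}. w e) \<noteq> (\<Sum>e\<in>{e \<in> edges G. v \<in> e}. w e))))"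

text \<open>The value is \<open>\<infinity>\<close> if no positive \<open>k\<close> works.\<close>

definition ch_edge_sum :: "'v ugraph \<Rightarrow> enat" where
  "ch_edge_sum G = (INF k\<in>{k. k > 0 \<and> edge_weight_choosable G k}. enat k)"

end

(* The coefficient of a product of linear forms at a monomial is, up to factorials, the permanent of
   the matrix whose columns are repeated according to the exponents; so it suffices to list at most
   k = degeneracy2 G copies of each edge whose columns have nonzero permanent. Permanents are
   multilinear, so columns may first be replaced by differences of columns.

   If u, v are nonadjacent with a common neighbour w and d(u) + d(v) = s <= k, the difference
   of the columns of uw and vw is supported, with entries 1 and -1, on the s rows at u or v.
   Repeating it s times clears these rows and uses only edges outside G - {u, v}. An isolated
   edge g created in G - {u, v} is cleared by one edge joining g to u or v; only if g = wb is a
   pendant edge are the columns wb, uw, vw and s - 2 differences used instead. The rest has no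
   isolated edge, so one can induct.

   Without such a pair all components are cliques. For adjacent u, v with p common
   neighbours x, two copies of uv and 2p - 1 differences ux - vx clear the rows at u and v;
   the neighbour used only once supplies the edge needed if an isolated edge is left over.

   The bound on the choosability number follows by the Combinatorial Nullstellensatz. *)

theory Submission
  imports Defs "HOL-Library.Multiset" "HOL-Library.FuncSet"
begin

subsection \<open>Permanents\<close>

text \<open>Laplace expansion along the first column. Columns form a list because they get repeated;
  rows form a set, as their order is irrelevant. A finite row set whose size differs from the number
  of columns gives 0.\<close>

fun per :: "('r \<Rightarrow> real) list \<Rightarrow> 'r set \<Rightarrow> real" where
  "per [] F = of_bool (F = {})"
| "per (c # cs) F = (\<Sum>f\<in>F. c f * per cs (F - {f}))"

lemma per_nonzero_length:
  assumes "finite F" "per cs F \<noteq> 0"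
  shows "length cs = card F"
  using assms
proof (induction cs arbitrary: F)
  case Nil
  then show ?case by simp
next
  case (Cons c cs)
  have "\<exists>f\<in>F. per cs (F - {f}) \<noteq> 0"
  proof (rule ccontr)
    assume "\<not> ?thesis"
    with Cons.prems(2) show False by simp
  qed
  then obtain f where f: "f \<in> F" "per cs (F - {f}) \<noteq> 0" by blast
  have "length cs = card (F - {f})" using Cons.prems(1) f(2) by (intro Cons.IH) auto
  then show ?case using card_Suc_Diff1[OF Cons.prems(1) f(1)] by simp
qed

text \<open>Block triangularity: inside \<open>F\<close> the columns \<open>cs\<close> live on
  \<open>S\<close> and are as many as the rows of \<open>S\<close>, so in every nonzero term they
  use up \<open>S\<close> and leave \<open>F - S\<close> to \<open>ds\<close>.\<close>

lemma per_append:
  assumes "finite F" "S \<subseteq> F" "length cs = card S"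
    and "\<forall>c\<in>set cs. \<forall>f\<in>F - S. c f = 0"
  shows "per (cs @ ds) F = per cs S * per ds (F - S)"
  using assms
proof (induction cs arbitrary: F S)
  case Nil
  have "finite S" using Nil.prems(1,2) by (rule rev_finite_subset)
  with Nil.prems(3) have "S = {}" by simp
  then show ?case by simp
next
  case (Cons c cs)
  have fS: "finite S" using Cons.prems(1,2) by (rule rev_finite_subset)
  have "per ((c # cs) @ ds) F = (\<Sum>f\<in>S. c f * per (cs @ ds) (F - {f}))"
    unfolding append_Cons per.simps
    by (rule sum.mono_neutral_right) (use Cons.prems(1,2,4) in auto)
  also have "\<dots> = (\<Sum>f\<in>S. c f * (per cs (S - {f}) * per ds (F - S)))"
  proof (rule sum.cong)
    fix f assume f: "f \<in> S"
    have "F - {f} - (S - {f}) = F - S" using f by blast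
    moreover have "per (cs @ ds) (F - {f}) = per cs (S - {f}) * per ds (F - {f} - (S - {f}))"
      using Cons.prems f fS by (intro Cons.IH) auto
    ultimately show "c f * per (cs @ ds) (F - {f}) = c f * (per cs (S - {f}) * per ds (F - S))"
      by simp
  qed simp
  finally show ?case by (simp add: sum_distrib_right mult.assoc)
qed

text \<open>The recursion of \<open>per\<close> fixes a column; here a row is fixed. Induction on
  the columns, interchanging the sums over rows and over positions.\<close>

lemma per_row_expansion:
  assumes "finite F" "f \<notin> F"
  shows "per cs (insert f F) = (\<Sum>i<length cs. (cs ! i) f * per (take i cs @ drop (Suc i) cs) F)"
  using assms
proof (induction cs arbitrary: F)
  case Nil
  then show ?case by simp
next
  case (Cons c cs)
  let ?del = "\<lambda>i. take i cs @ drop (Suc i) cs"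
  have "(\<Sum>g\<in>F. c g * per cs (insert f F - {g}))
      = (\<Sum>g\<in>F. c g * (\<Sum>i<length cs. (cs ! i) f * per (?del i) (F - {g})))"
  proof (rule sum.cong)
    fix g assume "g \<in> F"
    then have "insert f F - {g} = insert f (F - {g})" using Cons.prems by auto
    then show "c g * per cs (insert f F - {g})
        = c g * (\<Sum>i<length cs. (cs ! i) f * per (?del i) (F - {g}))"
      using Cons.prems by (simp add: Cons.IH)
  qed simp
  also have "\<dots> = (\<Sum>i<length cs. (cs ! i) f * (\<Sum>g\<in>F. c g * per (?del i) (F - {g})))"
    unfolding sum_distrib_left by (subst sum.swap) (simp add: mult.left_commute)
  finally show ?case
    using Cons.prems by (simp add: sum.lessThan_Suc_shift del: sum.lessThan_Suc)
qed

lemma per_diff: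
  "per (as @ (\<lambda>f. a f - b f) # bs) F = per (as @ a # bs) F - per (as @ b # bs) F"
  by (induction as arbitrary: F) (simp_all add: left_diff_distrib right_diff_distrib sum_subtractf)

text \<open>By \<open>per_diff\<close> a nonzero permanent with a difference column stays nonzero
  for one of the two terms. Resolving these columns one at a time turns differences back into
  columns of single edges.\<close>

lemma per_select:
  assumes "per (cs @ map (\<lambda>(x, y) f. col x f - col y f) zs @ ds) F \<noteq> 0"
  shows "\<exists>xs. list_all2 (\<lambda>x (y, z). x = y \<or> x = z) xs zs \<and> per (cs @ map col xs @ ds) F \<noteq> 0"
  using assms
proof (induction zs arbitrary: cs)
  case Nil
  then show ?case by simp
next
  case (Cons p zs)
  obtain x y where p: "p = (x, y)" by (cases p)
  let ?r = "map (\<lambda>(x, y) f. col x f - col y f) zs @ ds"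
  have "per (cs @ col x # ?r) F \<noteq> 0 \<or> per (cs @ col y # ?r) F \<noteq> 0"
    using Cons.prems by (auto simp: p per_diff)
  then obtain z where z: "z = x \<or> z = y" "per (cs @ col z # ?r) F \<noteq> 0" by blast
  from Cons.IH[of "cs @ [col z]"] z(2) obtain xs where
    "list_all2 (\<lambda>x (y, z). x = y \<or> x = z) xs zs" "per ((cs @ [col z]) @ map col xs @ ds) F \<noteq> 0"
    by auto
  then show ?case using z(1) by (intro exI[of _ "z # xs"]) (auto simp: p)
qed

lemma per_replicate:
  assumes "card F = n" "finite F"
  shows "per (replicate n d) F = fact n * prod d F"
  using assms
proof (induction n arbitrary: F)
  case 0
  then show ?case by simp
next
  case (Suc n)
  have "per (replicate (Suc n) d) F = (\<Sum>f\<in>F. d f * (fact n * prod d (F - {f})))"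
    using Suc by (auto intro!: sum.cong)
  also have "\<dots> = (\<Sum>f\<in>F. fact n * prod d F)"
    by (rule sum.cong) (use Suc.prems in \<open>auto simp: prod.remove[of F]\<close>)
  finally show ?case using Suc.prems by simp
qed

text \<open>Once \<open>p\<close> takes row \<open>f\<close>, the equal columns give a factorial
  times the product of \<open>d\<close> over the other rows, which is the full product divided by
  \<open>d f\<close>.\<close>

lemma per_Cons_replicate:
  assumes "card F = Suc n" "finite F" "\<And>f. f \<in> F \<Longrightarrow> d f \<noteq> 0"
  shows "per (p # replicate n d) F = fact n * prod d F * (\<Sum>f\<in>F. p f / d f)"
proof -
  have "per (p # replicate n d) F = (\<Sum>f\<in>F. p f * (fact n * prod d (F - {f})))"
    using assms by (auto intro!: sum.cong simp: per_replicate)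
  also have "\<dots> = (\<Sum>f\<in>F. fact n * prod d F * (p f / d f))"
    by (rule sum.cong) (use assms in \<open>auto simp: prod.remove[of F]\<close>)
  finally show ?thesis by (simp add: sum_distrib_left)
qed

text \<open>The columns \<open>p\<close> and \<open>q\<close> take distinct rows, so the sum over
  ordered pairs of rows is the product of two single sums minus the diagonal.\<close>

lemma per_Cons_Cons_replicate:
  assumes "card F = Suc (Suc n)" "finite F" "\<And>f. f \<in> F \<Longrightarrow> d f \<noteq> 0"
  shows "per (p # q # replicate n d) F = fact n * prod d F *
    ((\<Sum>f\<in>F. p f / d f) * (\<Sum>f\<in>F. q f / d f) - (\<Sum>f\<in>F. p f / d f * (q f / d f)))"
proof -
  let ?Q = "\<Sum>f\<in>F. q f / d f"
  have "per (p # q # replicate n d) F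
      = (\<Sum>f\<in>F. p f * (fact n * prod d (F - {f}) * (\<Sum>g\<in>F - {f}. q g / d g)))"
    unfolding per.simps(2)[of p]
  proof (rule sum.cong)
    fix f assume f: "f \<in> F"
    have "per (q # replicate n d) (F - {f})
        = fact n * prod d (F - {f}) * (\<Sum>g\<in>F - {f}. q g / d g)"
      by (rule per_Cons_replicate) (use f assms in auto)
    then show "p f * per (q # replicate n d) (F - {f})
        = p f * (fact n * prod d (F - {f}) * (\<Sum>g\<in>F - {f}. q g / d g))"
      by simp
  qed simp
  also have "\<dots> = (\<Sum>f\<in>F. fact n * prod d F * (p f / d f * (?Q - q f / d f)))"
    by (rule sum.cong) (use assms in \<open>auto simp: prod.remove[of F] sum_diff1\<close>)
  finally show ?thesis
    by (simp only: sum_distrib_left[symmetric] right_diff_distrib sum_subtractf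
        sum_distrib_right[symmetric])
qed

section \<open>Permanents with repeated columns\<close>

lemma sum_nth_eq_sum_count:
  fixes g :: "'e \<Rightarrow> real"
  assumes "finite X" "set es \<subseteq> X"
  shows "(\<Sum>i<length es. g (es ! i)) = (\<Sum>e\<in>X. real (count (mset es) e) * g e)"
  using assms(2)
proof (induction es)
  case Nil
  then show ?case by simp
next
  case (Cons a es)
  have "(\<Sum>e\<in>X. real (count (mset (a # es)) e) * g e)
      = (\<Sum>e\<in>X. real (count (mset es) e) * g e + (if e = a then g e else 0))"
    by (rule sum.cong) (auto simp: distrib_right)
  also have "\<dots> = (\<Sum>e\<in>X. real (count (mset es) e) * g e) + g a"
    using Cons.prems assms(1) by (simp add: sum.distrib)
  finally show ?case
    using Cons by (simp add: sum.lessThan_Suc_shift del: sum.lessThan_Suc)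
qed

text \<open>Think of \<open>K F N\<close> as the coefficient of the monomial \<open>N\<close> in the
  product over \<open>F\<close> of linear forms; the recurrence strips one factor. \<open>K\<close>
  is abstract because the lemma serves twice: for polynomial coefficients and for weighted sums over
  a grid. The latter involve the complement \<open>T - N\<close>, hence the restriction to
  \<open>N\<close> below \<open>T\<close>.\<close>

lemma per_eq_coefficient:
  assumes "finite F" "length es = card F" "mset es \<subseteq># T"
    and "K {} {#} = 1"
    and "\<And>f F N. finite F \<Longrightarrow> f \<notin> F \<Longrightarrow> size N = Suc (card F) \<Longrightarrow> N \<subseteq># T \<Longrightarrow>
      K (insert f F) N = (\<Sum>e\<in>set_mset N. col e f * K F (N - {#e#}))"
  shows "per (map col es) F = (\<Prod>e\<in>set_mset T. fact (count (mset es) e)) * K F (mset es)"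
  using assms(1-3)
proof (induction F arbitrary: es rule: finite_induct)
  case empty
  then show ?case using assms(4) by simp
next
  case (insert f F)
  \<comment> \<open>The index set is that of \<open>T\<close>, so it stays fixed when an entry is
    removed; entries of count 0 contribute \<open>fact 0 = 1\<close>.\<close>
  let ?c = "\<lambda>N. \<Prod>e\<in>set_mset T. fact (count N e) :: real"
  let ?del = "\<lambda>i. take i es @ drop (Suc i) es"
  let ?g = "\<lambda>e. col e f * ?c (mset es - {#e#}) * K F (mset es - {#e#})"
  have del: "mset (?del i) = mset es - {#es ! i#}" if "i < length es" for i
  proof -
    have "mset es = add_mset (es ! i) (mset (?del i))"
      by (subst id_take_nth_drop[OF that]) simp
    then show ?thesis by simp
  qed
  \<comment> \<open>Deleting any of the equal columns leaves the same minor; their number turns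
    \<open>fact m\<close> into \<open>fact (Suc m)\<close>.\<close>
  have c: "real (count (mset es) e) * ?c (mset es - {#e#}) = ?c (mset es)" if "e \<in># mset es" for e
  proof -
    have eT: "e \<in># T" by (rule mset_subset_eqD[OF insert.prems(2) that])
    have "count (mset es) e \<noteq> 0" using that by (simp only: count_eq_zero_iff not_not)
    then obtain m where m: "count (mset es) e = Suc m" by (rule not0_implies_Suc[THEN exE])
    let ?p = "\<Prod>x\<in>set_mset T - {e}. fact (count (mset es) x) :: real"
    have split: "?c N = fact (count N e) * (\<Prod>x\<in>set_mset T - {e}. fact (count N x))" for N
      by (rule prod.remove[OF finite_set_mset eT])
    have "(\<Prod>x\<in>set_mset T - {e}. fact (count (mset es - {#e#}) x)) = ?p"
      by (rule prod.cong) auto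
    then have "?c (mset es - {#e#}) = fact m * ?p"
      unfolding split[of "mset es - {#e#}"] by (simp add: m)
    moreover have "?c (mset es) = fact (Suc m) * ?p"
      unfolding split[of "mset es"] by (simp add: m)
    ultimately show ?thesis by (simp only: m fact_Suc mult.assoc)
  qed
  have "per (map col es) (insert f F)
      = (\<Sum>i<length es. col (es ! i) f * per (map col (?del i)) F)"
    using insert.hyps by (simp add: per_row_expansion take_map drop_map)
  also have "\<dots> = (\<Sum>i<length es. ?g (es ! i))"
  proof (rule sum.cong)
    fix i assume i: "i \<in> {..<length es}"
    have "mset (?del i) \<subseteq># T"
      using i insert.prems by (metis del diff_subset_eq_self lessThan_iff subset_mset.order_trans)
    then have "per (map col (?del i)) F = ?c (mset (?del i)) * K F (mset (?del i))"
      using i insert by (intro insert.IH) auto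
    then show "col (es ! i) f * per (map col (?del i)) F = ?g (es ! i)"
      using i by (simp add: del del: mset_append)
  qed simp
  also have "\<dots> = (\<Sum>e\<in>set es. real (count (mset es) e) * ?g e)"
    by (rule sum_nth_eq_sum_count) simp_all
  also have "\<dots> = (\<Sum>e\<in>set es. ?c (mset es) * (col e f * K F (mset es - {#e#})))"
  proof (rule sum.cong)
    fix e assume "e \<in> set es"
    then have "e \<in># mset es" by simp
    from c[OF this] show "real (count (mset es) e) * ?g e
        = ?c (mset es) * (col e f * K F (mset es - {#e#}))"
      by (metis mult.assoc mult.left_commute)
  qed simp
  also have "\<dots> = ?c (mset es) * K (insert f F) (mset es)"
    using insert assms(5)[of F f "mset es"] by (simp add: sum_distrib_left)
  finally show ?case .
qed


subsection \<open>Coefficients and the Combinatorial Nullstellensatz\<close>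

definition monomial :: "'x multiset \<Rightarrow> 'x \<Rightarrow>\<^sub>0 nat" where
  "monomial N = (\<Sum>e\<in>#N. Poly_Mapping.single e 1)"

lemma lookup_monomial [simp]: "Poly_Mapping.lookup (monomial N) e = count N e"
  by (induction N) (simp_all add: monomial_def lookup_add lookup_single when_def)

lemma lookup_single_times:
  fixes Q :: "'x mpoly"
  shows "Poly_Mapping.lookup (Poly_Mapping.single m c * Q) (m + k) = c * Poly_Mapping.lookup Q k"
  by (simp add: lookup_mult lookup_single when_mult)

lemma lookup_single_times_0:
  fixes Q :: "'x mpoly"
  assumes "\<And>k. t \<noteq> m + k"
  shows "Poly_Mapping.lookup (Poly_Mapping.single m c * Q) t = 0"
  using assms by (simp add: lookup_mult lookup_single when_mult)

lemma lookup_var_times: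
  fixes Q :: "'x mpoly"
  shows "Poly_Mapping.lookup (Poly_Mapping.single (Poly_Mapping.single e 1) c * Q) (monomial N)
    = (if e \<in># N then c * Poly_Mapping.lookup Q (monomial (N - {#e#})) else 0)"
proof (cases "e \<in># N")
  case True
  then have "monomial N = Poly_Mapping.single e 1 + monomial (N - {#e#})"
    by (auto simp: monomial_def dest!: multi_member_split)
  then show ?thesis using True by (simp only: lookup_single_times if_True)
next
  case False
  have "monomial N \<noteq> Poly_Mapping.single e 1 + k" for k
  proof
    assume "monomial N = Poly_Mapping.single e 1 + k"
    then have "Poly_Mapping.lookup (monomial N) e = Poly_Mapping.lookup (Poly_Mapping.single e 1 + k) e" by simp
    then show False using False by (simp add: lookup_add not_in_iff)
  qed
  then show ?thesis using False by (simp del: One_nat_def add: lookup_single_times_0)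
qed

text \<open>Multiplication by the linear form of a row gives exactly the recurrence of
  \<open>per_eq_coefficient\<close>, so permanent and coefficient differ by a product of
  factorials.\<close>

lemma per_nonzero_coefficient:
  fixes a :: "'x \<Rightarrow> 'r \<Rightarrow> real"
  assumes "finite F" "finite E" "set es \<subseteq> E" "per (map a es) F \<noteq> 0"
  shows "Poly_Mapping.lookup (\<Prod>f\<in>F. \<Sum>e\<in>E. Poly_Mapping.single (Poly_Mapping.single e 1) (a e f))
    (monomial (mset es)) \<noteq> 0"
proof -
  define K where "K F N = Poly_Mapping.lookup
    (\<Prod>f\<in>F. \<Sum>e\<in>E. Poly_Mapping.single (Poly_Mapping.single e 1) (a e f)) (monomial N)" for F N
  have "per (map a es) F = (\<Prod>e\<in>set_mset (mset es). fact (count (mset es) e)) * K F (mset es)"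
  proof (rule per_eq_coefficient[OF assms(1)])
    show "length es = card F" using per_nonzero_length[OF assms(1,4)] by simp
    show "K {} {#} = 1" by (simp add: K_def monomial_def)
    fix f :: 'r and F N assume F: "finite F" "f \<notin> F" and N: "N \<subseteq># mset es"
    have NE: "set_mset N \<subseteq> E" using set_mset_mono[OF N] assms(3) by simp
    have "K (insert f F) N = (\<Sum>e\<in>E. if e \<in># N then a e f * K F (N - {#e#}) else 0)"
      unfolding K_def using F by (simp add: sum_distrib_right lookup_sum lookup_var_times del: One_nat_def)
    also have "\<dots> = (\<Sum>e\<in>set_mset N. a e f * K F (N - {#e#}))"
      using NE assms(2) by (intro sum.mono_neutral_cong_right) auto
    finally show "K (insert f F) N = (\<Sum>e\<in>set_mset N. a e f * K F (N - {#e#}))" .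
  qed simp
  then show ?thesis using assms(4) by (simp add: K_def)
qed

text \<open>The functional is the divided difference on the nodes \<open>A\<close>: it kills all
  powers below \<open>t\<close> and sends the power \<open>t\<close> to 1.\<close>

lemma leading_power_functional:
  fixes A :: "'a::field set"
  assumes "finite A" "card A = Suc t"
  shows "\<exists>c. \<forall>j\<le>t. (\<Sum>x\<in>A. c x * x ^ j) = of_bool (j = t)"
  using assms
proof (induction t arbitrary: A)
  case 0
  then obtain a where "A = {a}" by (auto simp: card_1_singleton_iff)
  then show ?case by (intro exI[of _ "\<lambda>_. 1"]) simp
next
  case (Suc t)
  obtain a B where A: "A = insert a B" "a \<notin> B" "card B = Suc t"
    using Suc.prems(2) unfolding card_Suc_eq[of A "Suc t"] by blast
  have finB: "finite B" using Suc.prems(1) A(1) by simp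
  obtain c where c: "\<And>j. j \<le> t \<Longrightarrow> (\<Sum>x\<in>B. c x * x ^ j) = of_bool (j = t)"
    using Suc.IH[OF finB A(3)] by blast
  \<comment> \<open>Dividing by \<open>x - a\<close> makes the new functional on
    \<open>(x - a) * x ^ j\<close> agree with the old one on \<open>x ^ j\<close>; the weight at
    \<open>a\<close> is chosen so that constants are killed.\<close>
  define d where "d x = (if x = a then - (\<Sum>y\<in>B. c y / (y - a)) else c x / (x - a))" for x
  have dB: "(\<Sum>x\<in>B. d x * g x) = (\<Sum>x\<in>B. c x / (x - a) * g x)" for g
    by (rule sum.cong) (use A(2) in \<open>auto simp: d_def\<close>)
  have "(\<Sum>x\<in>A. d x * x ^ j) = of_bool (j = Suc t)" if "j \<le> Suc t" for j
    using that
  proof (induction j)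
    case 0
    then show ?case using dB[of "\<lambda>_. 1"] finB A(2) by (simp add: A(1)) (simp add: d_def)
  next
    case (Suc j)
    have "(\<Sum>x\<in>A. d x * x ^ Suc j) - a * (\<Sum>x\<in>A. d x * x ^ j) = (\<Sum>x\<in>A. d x * ((x - a) * x ^ j))"
      by (simp add: sum_distrib_left algebra_simps flip: sum_subtractf)
    also have "\<dots> = (\<Sum>x\<in>B. d x * ((x - a) * x ^ j))"
      using finB A(2) by (simp add: A(1))
    also have "\<dots> = (\<Sum>x\<in>B. c x * x ^ j)"
      unfolding dB by (rule sum.cong) (use A(2) in auto)
    finally show ?case using c[of j] Suc by simp
  qed
  then show ?case by blast
qed

text \<open>The coefficient form of the Combinatorial Nullstellensatz: applying to each variable a
  functional on its list that extracts the top power shows that the coefficient of a monomial of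
  top degree is a weighted sum of values on the grid.\<close>

lemma per_nonzero_grid:
  fixes a :: "'x \<Rightarrow> 'r \<Rightarrow> real"
  assumes F: "finite F" and E: "finite E" "set es \<subseteq> E" and nz: "per (map a es) F \<noteq> 0"
    and L: "\<And>e. e \<in> E \<Longrightarrow> count (mset es) e < card (L e)"
  shows "\<exists>w. (\<forall>e\<in>E. w e \<in> L e) \<and> (\<forall>f\<in>F. (\<Sum>e\<in>E. a e f * w e) \<noteq> 0)"
proof -
  let ?T = "mset es"
  have "\<exists>B c. B \<subseteq> L e \<and> finite B \<and>
      (\<forall>j\<le>count ?T e. (\<Sum>x\<in>B. c x * x ^ j) = of_bool (j = count ?T e))" if e: "e \<in> E" for e
  proof -
    obtain B where B: "B \<subseteq> L e" "card B = Suc (count ?T e)"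
      using obtain_subset_with_card_n[of "Suc (count ?T e)" "L e"] L[OF e] by auto
    then have "finite B" by (simp add: card_ge_0_finite)
    then show ?thesis using leading_power_functional[OF _ B(2)] B(1) by blast
  qed
  then obtain B c where B: "\<And>e. e \<in> E \<Longrightarrow> B e \<subseteq> L e" "\<And>e. e \<in> E \<Longrightarrow> finite (B e)"
    and c: "\<And>e j. e \<in> E \<Longrightarrow> j \<le> count ?T e \<Longrightarrow> (\<Sum>x\<in>B e. c e x * x ^ j) = of_bool (j = count ?T e)"
    by metis
  \<comment> \<open>The product of the functionals \<open>c e\<close>, applied to the monomial
    \<open>M\<close> times the product of the linear forms of the rows in \<open>F\<close>.\<close>
  define \<Phi> where "\<Phi> M F = (\<Sum>w\<in>PiE E B. (\<Prod>e\<in>E. c e (w e) * w e ^ count M e) *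
    (\<Prod>f\<in>F. \<Sum>e\<in>E. a e f * w e))" for M and F :: "'r set"
  have \<Phi>_empty: "\<Phi> M {} = (\<Prod>e\<in>E. \<Sum>x\<in>B e. c e x * x ^ count M e)" for M
    using E(1) B(2) by (simp add: \<Phi>_def prod_sum_PiE)
  have \<Phi>_insert: "\<Phi> M (insert f F) = (\<Sum>e\<in>E. a e f * \<Phi> (add_mset e M) F)"
    if "finite F" "f \<notin> F" for M f F
  proof -
    have shift: "(\<Prod>e'\<in>E. c e' (w e') * w e' ^ count (add_mset e M) e')
        = w e * (\<Prod>e'\<in>E. c e' (w e') * w e' ^ count M e')" if e: "e \<in> E" for e and w :: "'x \<Rightarrow> real"
    proof -
      have "(\<Prod>e'\<in>E - {e}. c e' (w e') * w e' ^ count (add_mset e M) e')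
          = (\<Prod>e'\<in>E - {e}. c e' (w e') * w e' ^ count M e')" by (rule prod.cong) auto
      then show ?thesis by (simp add: prod.remove[OF E(1) e] mult.assoc mult.left_commute)
    qed
    have "(\<Sum>e\<in>E. a e f * \<Phi> (add_mset e M) F)
        = (\<Sum>e\<in>E. \<Sum>w\<in>PiE E B. a e f * (w e * (\<Prod>e'\<in>E. c e' (w e') * w e' ^ count M e') *
            (\<Prod>f\<in>F. \<Sum>e\<in>E. a e f * w e)))"
      unfolding \<Phi>_def sum_distrib_left by (intro sum.cong refl) (simp only: shift)
    also have "\<dots> = (\<Sum>w\<in>PiE E B. \<Sum>e\<in>E. a e f * (w e * (\<Prod>e'\<in>E. c e' (w e') * w e' ^ count M e') *
            (\<Prod>f\<in>F. \<Sum>e\<in>E. a e f * w e)))" by (rule sum.swap)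
    also have "\<dots> = (\<Sum>w\<in>PiE E B. (\<Prod>e'\<in>E. c e' (w e') * w e' ^ count M e') *
            ((\<Sum>e\<in>E. a e f * w e) * (\<Prod>f\<in>F. \<Sum>e\<in>E. a e f * w e)))"
      by (rule sum.cong) (simp_all add: sum_distrib_left sum_distrib_right mult.assoc mult.left_commute mult.commute)
    also have "\<dots> = \<Phi> M (insert f F)" using that by (simp add: \<Phi>_def)
    finally show ?thesis by simp
  qed
  \<comment> \<open>Expanding all linear forms leads to monomials of the degree of \<open>?T\<close>
    that are still not below \<open>?T\<close>. Such a monomial has a smaller exponent than
    \<open>?T\<close> at some \<open>e\<close>, and the functional of \<open>e\<close> kills
    it.\<close>
  have zero: "\<Phi> M F = 0" if "finite F" "\<not> M \<subseteq># ?T" "size M + card F = size ?T" for M F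
    using that
  proof (induction F arbitrary: M rule: finite_induct)
    case empty
    have "\<exists>e. count M e < count ?T e"
    proof (rule ccontr)
      assume "\<not> ?thesis"
      then have "?T \<subseteq># M" by (simp add: subseteq_mset_def not_less)
      then have "?T = M" using empty.prems(2)
        by (metis add.right_neutral card.empty mset_subset_size nless_le subset_mset.le_imp_less_or_eq)
      then show False using empty.prems(1) by simp
    qed
    then obtain e where e: "count M e < count ?T e" by blast
    then have "e \<in># ?T" by (metis count_inI not_less_zero)
    then have eE: "e \<in> E" using E(2) by auto
    have "(\<Sum>x\<in>B e. c e x * x ^ count M e) = 0" using c[OF eE, of "count M e"] e by simp
    then show ?case unfolding \<Phi>_empty using E(1) eE by (auto simp: prod_zero_iff)
  next
    case (insert f F)
    have "\<Phi> (add_mset e M) F = 0" for e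
    proof (rule insert.IH)
      show "\<not> add_mset e M \<subseteq># ?T" using insert.prems(1) by (meson mset_subset_eq_insertD subset_mset.less_imp_le)
      show "size (add_mset e M) + card F = size ?T" using insert.prems(2) insert.hyps by simp
    qed
    then show ?case unfolding \<Phi>_insert[OF insert.hyps(1,2)] by simp
  qed
  \<comment> \<open>Multiplying by the complementary monomial \<open>?T - N\<close> makes the
    functional read off the coefficient of \<open>N\<close>. In the recurrence, the terms for
    \<open>e\<close> outside \<open>N\<close> vanish by \<open>zero\<close>.\<close>
  have "per (map a es) F = (\<Prod>e\<in>set_mset ?T. fact (count ?T e)) * \<Phi> (?T - ?T) F"
  proof (rule per_eq_coefficient[OF F, where K = "\<lambda>F N. \<Phi> (?T - N) F"])
    show "length es = card F" using per_nonzero_length[OF F nz] by simp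
    show "\<Phi> (?T - {#}) {} = 1" unfolding \<Phi>_empty using c by (intro prod.neutral) simp
    fix f :: 'r and F N assume N: "finite F" "f \<notin> F" "size N = Suc (card F)" "N \<subseteq># ?T"
    have NE: "set_mset N \<subseteq> E" using set_mset_mono[OF N(4)] E(2) by simp
    have "a e f * \<Phi> (add_mset e (?T - N)) F = 0" if "e \<notin># N" for e
    proof -
      have "\<not> add_mset e (?T - N) \<subseteq># ?T"
      proof
        assume "add_mset e (?T - N) \<subseteq># ?T"
        then have "count (add_mset e (?T - N)) e \<le> count ?T e" by (rule mset_subset_eq_count)
        then show False using that by (simp add: not_in_iff)
      qed
      moreover have "size (add_mset e (?T - N)) + card F = size ?T"
        using N(3) size_mset_mono[OF N(4)] by (simp add: size_Diff_submset[OF N(4)])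
      ultimately show ?thesis using zero[OF N(1)] by simp
    qed
    then have "\<Phi> (?T - N) (insert f F) = (\<Sum>e\<in>set_mset N. a e f * \<Phi> (add_mset e (?T - N)) F)"
      unfolding \<Phi>_insert[OF N(1,2)] using NE E(1) by (intro sum.mono_neutral_right) auto
    also have "\<dots> = (\<Sum>e\<in>set_mset N. a e f * \<Phi> (?T - (N - {#e#})) F)"
    proof (rule sum.cong)
      fix e assume e: "e \<in> set_mset N"
      have "add_mset e (?T - N) = ?T - (N - {#e#})"
        using mset_subset_eq_count[OF N(4)] e
        by (intro multiset_eqI) (auto simp: Suc_diff_le)
      then show "a e f * \<Phi> (add_mset e (?T - N)) F = a e f * \<Phi> (?T - (N - {#e#})) F" by simp
    qed simp
    finally show "\<Phi> (?T - N) (insert f F) = (\<Sum>e\<in>set_mset N. a e f * \<Phi> (?T - (N - {#e#})) F)" .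
  qed simp
  then have "\<Phi> {#} F \<noteq> 0" using nz by auto
  then obtain w where w: "w \<in> PiE E B" "(\<Prod>f\<in>F. \<Sum>e\<in>E. a e f * w e) \<noteq> 0"
    unfolding \<Phi>_def by (metis (no_types, lifting) mult_zero_right sum.neutral)
  then have "\<forall>f\<in>F. (\<Sum>e\<in>E. a e f * w e) \<noteq> 0" using F by (simp add: prod_zero_iff)
  moreover have "\<forall>e\<in>E. w e \<in> L e" using w(1) B(1) by (auto simp: PiE_def Pi_def)
  ultimately show ?thesis by blast
qed


subsection \<open>Clearing the rows at two vertices\<close>

locale oriented_graph =
  fixes G :: "'v ugraph" and A :: "('v \<times> 'v) set"
  assumes simple: "simple_graph G" and orient: "orientation G A"
begin

lemma finite_edges: "finite (edges G)"
proof (rule finite_subset)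
  show "edges G \<subseteq> Pow (verts G)" using simple by (auto simp: simple_graph_def)
  show "finite (Pow (verts G))" using simple by (simp add: simple_graph_def)
qed

lemma edge_card: "e \<in> edges G \<Longrightarrow> card e = 2"
  using simple by (simp add: simple_graph_def)

lemma edge_neq: "{x, y} \<in> edges G \<Longrightarrow> x \<noteq> y"
  by (auto dest: edge_card)

lemma arc_edge: "(x, y) \<in> A \<Longrightarrow> {x, y} \<in> edges G"
  using bij_betw_apply[OF orient[unfolded orientation_def], of "(x, y)"] by simp

lemma arc_neq: "(x, y) \<in> A \<Longrightarrow> x \<noteq> y"
  using arc_edge edge_neq by blast

lemma edge_arc:
  assumes "{x, y} \<in> edges G"
  shows "(x, y) \<in> A \<or> (y, x) \<in> A"
proof -
  have "{x, y} \<in> (\<lambda>(u, v). {u, v}) ` A"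
    using orient assms by (simp add: orientation_def bij_betw_def)
  then show ?thesis by (auto simp: doubleton_eq_iff)
qed

lemma arc_unique: "(x, y) \<in> A \<Longrightarrow> (x', y') \<in> A \<Longrightarrow> {x, y} = {x', y'} \<Longrightarrow> x = x' \<and> y = y'"
  using orient by (auto simp: orientation_def bij_betw_def inj_on_def)

lemma finite_arcs: "finite A"
  using bij_betw_finite[OF orient[unfolded orientation_def]] finite_edges by simp

definition arcs_in :: "'v set \<Rightarrow> ('v \<times> 'v) set" where
  "arcs_in W = {(x, y) \<in> A. x \<in> W \<and> y \<in> W}"

definition arcs_at :: "'v set \<Rightarrow> 'v \<Rightarrow> ('v \<times> 'v) set" where
  "arcs_at W u = {(x, y) \<in> arcs_in W. x = u \<or> y = u}"

text \<open>The coefficient of the variable \<open>e\<close> in the factor of the arc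
  \<open>(x, y)\<close>, so rows are arcs and columns are edges.\<close>

definition col :: "'v set \<Rightarrow> 'v \<times> 'v \<Rightarrow> real" where
  "col e = (\<lambda>(x, y). of_bool (y \<in> e) - of_bool (x \<in> e))"

text \<open>The column of \<open>{u, w}\<close> minus that of \<open>{v, w}\<close> for any third
  vertex \<open>w\<close>, whose contribution cancels.\<close>

definition diff_col :: "'v \<Rightarrow> 'v \<Rightarrow> 'v \<times> 'v \<Rightarrow> real" where
  "diff_col u v = (\<lambda>(x, y). of_bool (y = u) - of_bool (x = u) - of_bool (y = v) + of_bool (x = v))"

definition isolated_edges :: "'v set \<Rightarrow> 'v set set" where
  "isolated_edges W = {e \<in> edges G. e \<subseteq> W \<and> (\<forall>e'\<in>edges G. e' \<subseteq> W \<longrightarrow> e' \<inter> e \<noteq> {} \<longrightarrow> e' = e)}"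

lemma finite_arcs_in [simp]: "finite (arcs_in W)"
  by (rule finite_subset[OF _ finite_arcs]) (auto simp: arcs_in_def)

lemma finite_arcs_at [simp]: "finite (arcs_at W u)"
  by (rule finite_subset[OF _ finite_arcs]) (auto simp: arcs_in_def arcs_at_def)

lemma finite_isolated_edges: "finite (isolated_edges W)"
  by (rule finite_subset[OF _ finite_edges]) (auto simp: isolated_edges_def)

lemma col_diff_col:
  assumes "w \<noteq> u" "w \<noteq> v"
  shows "(\<lambda>f. col {u, w} f - col {v, w} f) = diff_col u v"
  using assms by (auto simp: col_def diff_col_def fun_eq_iff)

lemma card_arcs_at:
  "card (arcs_at W u) = degree (induced G W) u"
proof -
  have "bij_betw (\<lambda>(x, y). {x, y}) (arcs_at W u) {e \<in> edges (induced G W). u \<in> e}"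
  proof (rule bij_betw_imageI)
    show "inj_on (\<lambda>(x, y). {x, y}) (arcs_at W u)"
      by (rule inj_on_subset[OF bij_betw_imp_inj_on[OF orient[unfolded orientation_def]]])
        (auto simp: arcs_at_def arcs_in_def)
    have "e \<in> (\<lambda>(x, y). {x, y}) ` arcs_at W u"
      if e: "e \<in> edges G" "e \<subseteq> W" "u \<in> e" for e
    proof -
      obtain a b where ab: "e = {a, b}" using edge_card[OF e(1)] by (auto simp: card_2_iff)
      then have "(a, b) \<in> arcs_at W u \<or> (b, a) \<in> arcs_at W u"
        using edge_arc[of a b] e by (auto simp: arcs_at_def arcs_in_def)
      then show ?thesis
      proof
        assume "(b, a) \<in> arcs_at W u"
        then show ?thesis unfolding ab by (rule rev_image_eqI) auto
      qed (simp add: ab rev_image_eqI)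
    qed
    then show "(\<lambda>(x, y). {x, y}) ` arcs_at W u = {e \<in> edges (induced G W). u \<in> e}"
      using arc_edge by (auto simp: induced_def arcs_at_def arcs_in_def)
  qed
  then show ?thesis unfolding degree_def by (rule bij_betw_same_card)
qed

lemma degree_induced:
  assumes "u \<in> W"
  shows "degree (induced G W) u = card {x \<in> W. {u, x} \<in> edges G}"
proof -
  have "{e \<in> edges (induced G W). u \<in> e} = (\<lambda>x. {u, x}) ` {x \<in> W. {u, x} \<in> edges G}"
  proof (intro equalityI subsetI)
    fix e assume "e \<in> {e \<in> edges (induced G W). u \<in> e}"
    then have e: "e \<in> edges G" "e \<subseteq> W" "u \<in> e" by (auto simp: induced_def)
    obtain a b where "e = {a, b}" using edge_card[OF e(1)] by (auto simp: card_2_iff)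
    then obtain x where x: "e = {u, x}" using e(3) by blast
    show "e \<in> (\<lambda>x. {u, x}) ` {x \<in> W. {u, x} \<in> edges G}"
      unfolding x by (rule imageI) (use e x in auto)
  next
    fix e assume "e \<in> (\<lambda>x. {u, x}) ` {x \<in> W. {u, x} \<in> edges G}"
    then show "e \<in> {e \<in> edges (induced G W). u \<in> e}"
      using assms by (auto simp: induced_def)
  qed
  moreover have "inj_on (\<lambda>x. {u, x}) {x \<in> W. {u, x} \<in> edges G}"
    by (rule inj_onI) (auto simp: doubleton_eq_iff)
  ultimately show ?thesis unfolding degree_def by (simp add: card_image)
qed

lemma arcs_in_remove: "arcs_in W - arcs_in (W - {u, v}) = arcs_at W u \<union> arcs_at W v"
  by (auto simp: arcs_at_def arcs_in_def)

section \<open>Isolated edges after deleting two vertices\<close>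

lemma isolated_edgesD:
  assumes "g \<in> isolated_edges W"
  shows "g \<in> edges G" "g \<subseteq> W"
    and "e \<in> edges G \<Longrightarrow> e \<subseteq> W \<Longrightarrow> a \<in> e \<Longrightarrow> a \<in> g \<Longrightarrow> e = g"
  using assms unfolding isolated_edges_def by blast+

lemma isolated_edges_disjoint:
  "g \<in> isolated_edges R \<Longrightarrow> h \<in> isolated_edges R \<Longrightarrow> a \<in> g \<Longrightarrow> a \<in> h \<Longrightarrow> g = h"
  using isolated_edgesD by metis

lemma arcs_in_remainder:
  "arcs_in (R - \<Union> (isolated_edges R)) = {(x, y) \<in> arcs_in R. {x, y} \<notin> isolated_edges R}"
proof -
  have "{x, y} \<in> isolated_edges R" if "(x, y) \<in> arcs_in R" "g \<in> isolated_edges R" "x \<in> g \<or> y \<in> g" for x y g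
  proof -
    have "{x, y} \<in> edges G" "{x, y} \<subseteq> R" using that(1) arc_edge by (auto simp: arcs_in_def)
    then have "{x, y} = g" using isolated_edgesD(3)[OF that(2), of "{x, y}"] that(3) by blast
    then show ?thesis using that(2) by simp
  qed
  then show ?thesis by (auto simp: arcs_in_def)
qed

text \<open>An edge \<open>{x, a}\<close> leaving \<open>R\<close> at an end \<open>a\<close> of an isolated edge \<open>g\<close> of \<open>R\<close> has a column
  that is nonzero only in the row of \<open>g\<close>, so that row and that column split off.\<close>

lemma per_isolated_edges:
  assumes "distinct gs" "set gs \<union> X = isolated_edges R" "set gs \<inter> X = {}"
    and "\<forall>g\<in>set gs. \<exists>x a. \<phi> g = {x, a} \<and> x \<notin> R \<and> a \<in> g"
    and "per cs (arcs_in (R - \<Union> (isolated_edges R))) \<noteq> 0"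
  shows "per (map (\<lambda>g. col (\<phi> g)) gs @ cs) {(x, y) \<in> arcs_in R. {x, y} \<notin> X} \<noteq> 0"
  using assms(1-4)
proof (induction gs arbitrary: X)
  case Nil
  have "X = isolated_edges R" using Nil.prems(2) by simp
  then show ?case using assms(5) by (simp add: arcs_in_remainder)
next
  case (Cons g gs)
  let ?F = "{(x, y) \<in> arcs_in R. {x, y} \<notin> X}"
  have gI: "g \<in> isolated_edges R" and gX: "g \<notin> X" using Cons.prems(2,3) by auto
  note g = isolated_edgesD[OF gI]
  obtain x a where xa: "\<phi> g = {x, a}" "x \<notin> R" "a \<in> g" using Cons.prems(4) by auto
  obtain p q where pq: "g = {p, q}" "(p, q) \<in> A"
  proof -
    obtain a b where ab: "g = {a, b}" using edge_card[OF g(1)] by (auto simp: card_2_iff)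
    moreover have "g = {b, a}" using ab by blast
    ultimately show ?thesis using that edge_arc[of a b] g(1) by blast
  qed
  have pqF: "(p, q) \<in> ?F" using pq g(2) gX by (auto simp: arcs_in_def)
  have "p \<noteq> q" using pq arc_neq by blast
  then have one: "col (\<phi> g) (p, q) \<noteq> 0"
    using xa pq g(2) by (auto simp: col_def)
  \<comment> \<open>Deleting the row of \<open>g\<close> amounts to moving \<open>g\<close> into
    \<open>X\<close>, the set of isolated edges already cleared.\<close>
  have F: "?F - {(p, q)} = {(x, y) \<in> arcs_in R. {x, y} \<notin> insert g X}"
    using pq arc_unique[OF _ pq(2)] by (auto simp: arcs_in_def)
  have zero: "col (\<phi> g) (y, z) = 0" if "(y, z) \<in> ?F - {(p, q)}" for y z
  proof -
    have yz: "(y, z) \<in> A" "y \<in> R" "z \<in> R" "{y, z} \<noteq> g"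
      using that unfolding F by (auto simp: arcs_in_def)
    have "a \<noteq> y \<and> a \<noteq> z" using g(3)[of "{y, z}" a] arc_edge[OF yz(1)] yz(2-4) xa(3) by auto
    then show ?thesis using xa yz by (auto simp: col_def)
  qed
  have "per ([col (\<phi> g)] @ (map (\<lambda>g. col (\<phi> g)) gs @ cs)) ?F
      = per [col (\<phi> g)] {(p, q)} * per (map (\<lambda>g. col (\<phi> g)) gs @ cs) (?F - {(p, q)})"
  proof (rule per_append)
    show "finite ?F" by (rule finite_subset[OF _ finite_arcs_in[of R]]) auto
    show "\<forall>c\<in>set [col (\<phi> g)]. \<forall>f\<in>?F - {(p, q)}. c f = 0"
      using zero by (auto simp del: Diff_iff)
  qed (use pqF in auto)
  moreover have "per (map (\<lambda>g. col (\<phi> g)) gs @ cs) (?F - {(p, q)}) \<noteq> 0"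
    unfolding F
  proof (rule Cons.IH)
    show "set gs \<union> insert g X = isolated_edges R" using Cons.prems(2) by auto
    show "set gs \<inter> insert g X = {}" using Cons.prems(1,3) by auto
  qed (use Cons.prems(1,4) in auto)
  ultimately show ?case using one by simp
qed

text \<open>Discarding whole components leaves the others intact: an edge isolated afterwards was
  isolated before, and would have been discarded.\<close>

lemma isolated_edges_remainder:
  "isolated_edges (R - \<Union> (isolated_edges R)) = {}"
proof (rule ccontr)
  let ?R = "R - \<Union> (isolated_edges R)"
  assume "isolated_edges ?R \<noteq> {}"
  then obtain e where eI: "e \<in> isolated_edges ?R" by blast
  note e = isolated_edgesD[OF eI]
  have "e \<noteq> {}" using edge_card[OF e(1)] by auto
  then have "e \<notin> isolated_edges R" using e(2) by blast
  then obtain e' a where e': "e' \<in> edges G" "e' \<subseteq> R" "a \<in> e'" "a \<in> e" "e' \<noteq> e"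
    using e(1,2) unfolding isolated_edges_def by blast
  then have "\<not> e' \<subseteq> ?R" using e(3)[of e' a] by blast
  then obtain g b where g: "g \<in> isolated_edges R" "b \<in> e'" "b \<in> g" using e'(2) by blast
  then have "e' = g" using isolated_edgesD(3)[OF g(1) e'(1,2) g(2,3)] by simp
  then show False using g(1) e(2) e'(3,4) by blast
qed

text \<open>As \<open>g\<close> is not isolated in \<open>W\<close>, another edge of
  \<open>W\<close> meets it; that edge must leave \<open>W - {u, v}\<close>, and it can do so only
  at \<open>u\<close> or \<open>v\<close>.\<close>

lemma isolated_edge_attached:
  assumes "isolated_edges W = {}" "g \<in> isolated_edges (W - {u, v})"
  shows "\<exists>x a. {x, a} \<in> edges G \<and> {x, a} \<subseteq> W \<and> x \<in> {u, v} \<and> a \<in> g"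
proof -
  note g = isolated_edgesD[OF assms(2)]
  have "g \<notin> isolated_edges W" using assms(1) by simp
  then obtain e a where e: "e \<in> edges G" "e \<subseteq> W" "a \<in> e" "a \<in> g" "e \<noteq> g"
    using g(1,2) unfolding isolated_edges_def by blast
  then obtain x where x: "x \<in> e" "x \<in> {u, v}" using g(3)[OF e(1) _ e(3,4)] by blast
  have "x \<noteq> a" using e(4) x g(2) by blast
  moreover obtain p q where "e = {p, q}" using edge_card[OF e(1)] by (auto simp: card_2_iff)
  ultimately have "e = {x, a}" using e(3) x(1) by auto
  then show ?thesis using e x by blast
qed

text \<open>The matrix is block triangular in three stages: \<open>cs\<close> clears the rows
  \<open>T\<close> at \<open>u\<close>, \<open>v\<close> and in \<open>J\<close>, the edges
  \<open>\<phi> g\<close> clear the remaining isolated edges, and \<open>rs\<close> handles the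
  rest. Only afterwards are the difference columns resolved into edges.\<close>

lemma per_step:
  assumes "J \<subseteq> isolated_edges (W - {u, v})"
    and T: "T = arcs_at W u \<union> arcs_at W v \<union> {(x, y) \<in> arcs_in (W - {u, v}). {x, y} \<in> J}"
    and cs: "cs = map col es @ map (\<lambda>(x, y) f. col x f - col y f) zs"
    and vanish: "\<forall>c\<in>set cs. \<forall>f\<in>arcs_in (W - {u, v}) - T. c f = 0"
    and nz: "per cs T \<noteq> 0"
    and gs: "distinct gs" "set gs = isolated_edges (W - {u, v}) - J"
    and phi: "\<forall>g\<in>set gs. \<exists>x a. \<phi> g = {x, a} \<and> x \<in> {u, v} \<and> a \<in> g"
    and rest: "per (map col rs) (arcs_in (W - {u, v} - \<Union> (isolated_edges (W - {u, v})))) \<noteq> 0"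
  shows "\<exists>xs. list_all2 (\<lambda>x (y, z). x = y \<or> x = z) xs zs \<and>
    per (map col (es @ xs @ map \<phi> gs @ rs)) (arcs_in W) \<noteq> 0"
proof -
  let ?R = "W - {u, v}"
  have sub: "T \<subseteq> arcs_in W" unfolding T by (auto simp: arcs_at_def arcs_in_def)
  have remain: "arcs_in W - T = arcs_in ?R - T"
    unfolding T arcs_in_remove[symmetric] by (auto simp: arcs_in_def)
  have remain': "arcs_in ?R - T = {(x, y) \<in> arcs_in ?R. {x, y} \<notin> J}"
    unfolding T by (auto simp: arcs_at_def arcs_in_def)
  have "finite T" using sub by (rule finite_subset) simp
  then have "length cs = card T" using nz by (rule per_nonzero_length)
  then have "per (cs @ map (\<lambda>g. col (\<phi> g)) gs @ map col rs) (arcs_in W)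
      = per cs T * per (map (\<lambda>g. col (\<phi> g)) gs @ map col rs) (arcs_in W - T)"
    using vanish sub by (intro per_append) (auto simp only: remain finite_arcs_in)
  moreover have "per (map (\<lambda>g. col (\<phi> g)) gs @ map col rs) (arcs_in W - T) \<noteq> 0"
    unfolding remain remain'
  proof (rule per_isolated_edges)
    show "\<forall>g\<in>set gs. \<exists>x a. \<phi> g = {x, a} \<and> x \<notin> ?R \<and> a \<in> g" using phi by blast
  qed (use gs assms(1) rest in auto)
  ultimately have "per (map col es @ map (\<lambda>(x, y) f. col x f - col y f) zs
      @ (map col (map \<phi> gs @ rs))) (arcs_in W) \<noteq> 0"
    using nz by (simp add: cs comp_def)
  from per_select[OF this] show ?thesis by simp
qed

lemma count_list_distinct: "distinct xs \<Longrightarrow> count_list xs x \<le> 1"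
  by (induction xs) auto

lemma count_choice:
  assumes "list_all2 (\<lambda>x (y, z). x = y \<or> x = z) xs zs"
  shows "count_list xs e \<le> length (filter (\<lambda>(y, z). e = y \<or> e = z) zs)"
  using assms by (induction xs zs rule: list_all2_induct) auto

lemma choice_set:
  assumes "list_all2 (\<lambda>x (y, z). x = y \<or> x = z) xs zs"
  shows "set xs \<subseteq> fst ` set zs \<union> snd ` set zs"
  using assms by (induction xs zs rule: list_all2_induct) auto

text \<open>The end of \<open>\<phi> g\<close> outside \<open>{u, v}\<close> lies in
  \<open>g\<close>, and isolated edges are disjoint, so \<open>\<phi> g\<close> determines
  \<open>g\<close>.\<close>

lemma distinct_attached:
  assumes "distinct gs" "set gs \<subseteq> isolated_edges (W - {u, v})"
    and phi: "\<forall>g\<in>set gs. \<exists>x a. \<phi> g = {x, a} \<and> x \<in> {u, v} \<and> a \<in> g"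
  shows "distinct (map \<phi> gs)"
proof -
  have "g = h" if gh: "g \<in> set gs" "h \<in> set gs" "\<phi> g = \<phi> h" for g h
  proof -
    obtain x a where xa: "\<phi> g = {x, a}" "x \<in> {u, v}" "a \<in> g" using phi gh(1) by blast
    obtain y b where yb: "\<phi> h = {y, b}" "y \<in> {u, v}" "b \<in> h" using phi gh(2) by blast
    have gI: "g \<in> isolated_edges (W - {u, v})" "h \<in> isolated_edges (W - {u, v})"
      using gh(1,2) assms(2) by auto
    have "a \<noteq> y" using isolated_edgesD(2)[OF gI(1)] xa(3) yb(2) by blast
    moreover have "a \<in> {y, b}" using xa(1) yb(1) gh(3) by auto
    ultimately have "a \<in> h" using yb(3) by simp
    then show ?thesis by (rule isolated_edges_disjoint[OF gI xa(3)])
  qed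
  then have "inj_on \<phi> (set gs)" by (rule inj_onI)
  then show ?thesis using assms(1) by (simp add: distinct_map)
qed

section \<open>Nonzero permanents on the rows at two vertices\<close>

lemma diff_col_nonzero:
  assumes "u \<noteq> v" "{u, v} \<notin> edges G" "f \<in> arcs_at W u \<union> arcs_at W v"
  shows "diff_col u v f \<noteq> 0"
proof -
  obtain x y where f: "f = (x, y)" by (cases f)
  have xy: "(x, y) \<in> A" "x = u \<or> y = u \<or> x = v \<or> y = v"
    using assms(3) by (auto simp: f arcs_at_def arcs_in_def)
  have "x \<noteq> y" using arc_neq xy by blast
  moreover have "\<not> (x = u \<and> y = v)" "\<not> (x = v \<and> y = u)"
    using arc_edge[OF xy(1)] assms(2) by (auto simp: insert_commute)
  ultimately show ?thesis using assms(1) xy(2) by (auto simp: f diff_col_def)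
qed

lemma per_nonadjacent:
  assumes "u \<noteq> v" "{u, v} \<notin> edges G" "card (arcs_at W u \<union> arcs_at W v) = n"
  shows "per (replicate n (diff_col u v)) (arcs_at W u \<union> arcs_at W v) \<noteq> 0"
  using diff_col_nonzero[OF assms(1,2)] by (subst per_replicate[OF assms(3)]) auto

text \<open>In the next two lemmas the sum of the entries of the column \<open>{w, b}\<close>, respectively \<open>{u, v}\<close>,
  divided by those of the difference column vanishes, so only the diagonal correction term of
  \<open>per_Cons_Cons_replicate\<close> survives.\<close>

lemma per_pendant:
  assumes uv: "u \<noteq> v" "{u, v} \<notin> edges G" and W: "u \<in> W" "v \<in> W" "w \<in> W" "b \<in> W"
    and w: "{u, w} \<in> edges G" "{v, w} \<in> edges G" "{w, b} \<in> edges G" "b \<noteq> u" "b \<noteq> v"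
    and b: "{u, b} \<notin> edges G" "{v, b} \<notin> edges G"
    and n: "card (arcs_at W u \<union> arcs_at W v) = Suc (Suc n)"
    and m: "m \<in> A" "m = (w, b) \<or> m = (b, w)"
  shows "per (col {w, b} # col {u, w} # col {v, w} # replicate n (diff_col u v))
    (insert m (arcs_at W u \<union> arcs_at W v)) \<noteq> 0"
proof -
  let ?S = "arcs_at W u \<union> arcs_at W v"
  let ?D = "diff_col u v"
  let ?q = "col {w, b}"
  let ?r = "replicate n ?D"
  have ne: "w \<noteq> u" "w \<noteq> v" "w \<noteq> b" using edge_neq w by blast+
  have D: "?D f \<noteq> 0" if "f \<in> ?S" for f using diff_col_nonzero[OF uv that] .
  have mS: "m \<notin> ?S" using m ne w(4,5) by (auto simp: arcs_at_def)
  define c where "c = col {u, w} m"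
  have c: "c \<noteq> 0" "col {u, w} m = c" "col {v, w} m = c" "?q m = 0" "?D m = 0"
    using m(2) ne w(4,5) by (auto simp: col_def diff_col_def c_def)
  \<comment> \<open>Expansion along row \<open>m\<close>: there \<open>?q\<close> and
    \<open>?D\<close> vanish, while the columns of \<open>{u, w}\<close> and \<open>{v, w}\<close>
    have the same entry \<open>c\<close>.\<close>
  have "per (?q # col {u, w} # col {v, w} # ?r) (insert m ?S)
      = c * per (?q # col {v, w} # ?r) ?S + c * per (?q # col {u, w} # ?r) ?S"
  proof -
    have fS: "finite ?S" by simp
    show ?thesis
      using c by (simp add: per_row_expansion[OF fS mS] sum.lessThan_Suc_shift
          del: sum.lessThan_Suc per.simps Un_iff)
  qed
  \<comment> \<open>Both minors have the same value, so the two terms add up instead of cancelling.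
    Among the rows \<open>?S\<close>, the column \<open>?q\<close> meets only the arcs
    \<open>r1\<close> and \<open>r2\<close> at \<open>w\<close>, where its quotients by
    \<open>?D\<close> are opposite.\<close>
  moreover have "per (?q # p # ?r) ?S = - (fact n * prod ?D ?S)"
    if p: "p = col {u, w} \<or> p = col {v, w}" for p
  proof -
    obtain r1 where r1: "r1 \<in> A" "r1 = (u, w) \<or> r1 = (w, u)" using edge_arc[OF w(1)] by blast
    obtain r2 where r2: "r2 \<in> A" "r2 = (v, w) \<or> r2 = (w, v)" using edge_arc[OF w(2)] by blast
    have r12: "r1 \<noteq> r2" using r1(2) r2(2) ne uv(1) by auto
    have rS: "{r1, r2} \<subseteq> ?S" using r1 r2 W by (auto simp: arcs_at_def arcs_in_def)
    have q0: "?q f = 0" if f: "f \<in> ?S - {r1, r2}" for f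
    proof -
      obtain x y where xy: "f = (x, y)" by (cases f)
      have fA: "(x, y) \<in> A" and at: "x = u \<or> y = u \<or> x = v \<or> y = v"
        using f by (auto simp: xy arcs_at_def arcs_in_def)
      note e = arc_edge[OF fA]
      have "x \<noteq> b" "y \<noteq> b" using at e b w(4,5) by (auto simp: insert_commute)
      moreover have "{x, y} \<noteq> {u, w}" "{x, y} \<noteq> {v, w}"
        using f r1 r2 arc_unique[OF fA, of u w] arc_unique[OF fA, of w u]
          arc_unique[OF fA, of v w] arc_unique[OF fA, of w v] by (auto simp: xy insert_commute)
      then have "x \<noteq> w" "y \<noteq> w" using at ne by auto
      ultimately show ?thesis by (simp add: xy col_def)
    qed
    have "(\<Sum>f\<in>?S. ?q f / ?D f) = (\<Sum>f\<in>{r1, r2}. ?q f / ?D f)"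
      using rS q0 by (intro sum.mono_neutral_right) auto
    also have "\<dots> = 0"
      using r12 r1(2) r2(2) ne uv(1) w(4,5) by (auto simp: col_def diff_col_def)
    finally have s1: "(\<Sum>f\<in>?S. ?q f / ?D f) = 0" .
    have "(\<Sum>f\<in>?S. ?q f / ?D f * (p f / ?D f)) = (\<Sum>f\<in>{r1, r2}. ?q f / ?D f * (p f / ?D f))"
      using rS q0 by (intro sum.mono_neutral_right) auto
    also have "\<dots> = 1"
      using r12 r1(2) r2(2) ne uv(1) w(4,5) p by (auto simp: col_def diff_col_def)
    finally have s2: "(\<Sum>f\<in>?S. ?q f / ?D f * (p f / ?D f)) = 1" .
    show ?thesis
      by (subst per_Cons_Cons_replicate[OF n]) (use D s1 s2 in auto)
  qed
  ultimately have "per (?q # col {u, w} # col {v, w} # ?r) (insert m ?S)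
      = - 2 * c * (fact n * prod ?D ?S)" by simp
  moreover have "prod ?D ?S \<noteq> 0" using D by (simp add: prod_zero_iff)
  ultimately show ?thesis using c(1) by simp
qed

lemma per_adjacent:
  assumes uv: "u \<noteq> v" and m: "m \<in> A" "m = (u, v) \<or> m = (v, u)" and W: "u \<in> W" "v \<in> W"
    and n: "card (arcs_at W u) = Suc (Suc n)" "card (arcs_at W v) = Suc (Suc n)"
  shows "per (col {u, v} # col {u, v} # replicate (Suc (2 * n)) (diff_col u v))
    (arcs_at W u \<union> arcs_at W v) \<noteq> 0"
proof -
  let ?Su = "arcs_at W u - {m}" and ?Sv = "arcs_at W v - {m}"
  let ?S = "?Su \<union> ?Sv"
  let ?D = "diff_col u v"
  let ?p = "col {u, v}"
  let ?r = "\<lambda>n. replicate n ?D"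
  have mm: "m \<in> arcs_at W u" "m \<in> arcs_at W v" using m W by (auto simp: arcs_at_def arcs_in_def)
  then have S: "arcs_at W u \<union> arcs_at W v = insert m ?S" by auto
  have other: "{x, y} \<noteq> {u, v}" if "(x, y) \<in> ?S" for x y
  proof -
    have xy: "(x, y) \<in> A" "(x, y) \<noteq> m" using that by (auto simp: arcs_at_def arcs_in_def)
    then show ?thesis
      using m arc_unique[OF xy(1), of u v] arc_unique[OF xy(1), of v u] by (auto simp: insert_commute)
  qed
  \<comment> \<open>The quotient is 1 on the arcs at \<open>u\<close> and -1 on those at
    \<open>v\<close>. This makes the two sets disjoint and, as they have equal size, makes the sum
    vanish, whereas the squares add up to \<open>card ?S\<close>.\<close>
  have du: "?D f \<noteq> 0 \<and> ?p f / ?D f = 1" if f: "f \<in> ?Su" for f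
  proof -
    obtain x y where xy: "f = (x, y)" by (cases f)
    have "(x, y) \<in> A" "x = u \<or> y = u" using f by (auto simp: xy arcs_at_def arcs_in_def)
    moreover have "{x, y} \<noteq> {u, v}" using other[of x y] f by (simp add: xy)
    ultimately show ?thesis using arc_neq[of x y] uv
      by (auto simp: xy col_def diff_col_def insert_commute)
  qed
  have dv: "?D f \<noteq> 0 \<and> ?p f / ?D f = - 1" if f: "f \<in> ?Sv" for f
  proof -
    obtain x y where xy: "f = (x, y)" by (cases f)
    have "(x, y) \<in> A" "x = v \<or> y = v" using f by (auto simp: xy arcs_at_def arcs_in_def)
    moreover have "{x, y} \<noteq> {u, v}" using other[of x y] f by (simp add: xy)
    ultimately show ?thesis using arc_neq[of x y] uv
      by (auto simp: xy col_def diff_col_def insert_commute)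
  qed
  have disj: "?Su \<inter> ?Sv = {}"
  proof (rule ccontr)
    assume "?Su \<inter> ?Sv \<noteq> {}"
    then obtain f where "f \<in> ?Su" "f \<in> ?Sv" by blast
    then show False using du[of f] dv[of f] by simp
  qed
  have cu: "card ?Su = Suc n" "card ?Sv = Suc n" using n mm by simp_all
  have cS: "card ?S = Suc (Suc (2 * n))"
    by (subst card_Un_disjoint) (use disj cu in auto)
  have D: "?D f \<noteq> 0" if "f \<in> ?S" for f using that du dv by blast
  have "(\<Sum>f\<in>?S. ?p f / ?D f) = (\<Sum>f\<in>?Su. ?p f / ?D f) + (\<Sum>f\<in>?Sv. ?p f / ?D f)"
    by (rule sum.union_disjoint) (use disj in auto)
  also have "(\<Sum>f\<in>?Su. ?p f / ?D f) = (\<Sum>f\<in>?Su. 1)"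
    by (rule sum.cong) (use du in blast)+
  also have "(\<Sum>f\<in>?Sv. ?p f / ?D f) = (\<Sum>f\<in>?Sv. - 1)"
    by (rule sum.cong) (use dv in blast)+
  finally have s1: "(\<Sum>f\<in>?S. ?p f / ?D f) = 0" using cu by simp
  have "(\<Sum>f\<in>?S. ?p f / ?D f * (?p f / ?D f)) = (\<Sum>f\<in>?S. 1)"
  proof (rule sum.cong)
    fix f assume "f \<in> ?S"
    then have "?p f / ?D f = 1 \<or> ?p f / ?D f = - 1" using du dv by blast
    then show "?p f / ?D f * (?p f / ?D f) = 1" by (elim disjE) (simp_all only: mult_1 minus_mult_minus)
  qed simp
  then have s2: "(\<Sum>f\<in>?S. ?p f / ?D f * (?p f / ?D f)) = real (card ?S)" by simp
  have P: "per (?p # ?p # ?r (2 * n)) ?S \<noteq> 0"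
  proof -
    have "prod ?D ?S \<noteq> 0" using D by (simp add: prod_zero_iff)
    then show ?thesis
      by (subst per_Cons_Cons_replicate[OF cS]) (use D s1 s2 cS in auto)
  qed
  have Dm: "?p m = 0" "?D m \<noteq> 0" using m(2) uv by (auto simp: col_def diff_col_def)
  have del: "take i (?r (Suc k)) @ drop (Suc i) (?r (Suc k)) = ?r k" if "i < Suc k" for i k
    using that by (simp add: min_def del: replicate_Suc flip: replicate_add)
  have nth: "?r (Suc k) ! i = ?D" if "i < Suc k" for i k
    using that by (simp del: replicate_Suc)
  \<comment> \<open>In row \<open>m\<close> the column \<open>?p\<close> vanishes, so only the
    \<open>2 * n + 1\<close> equal difference columns contribute, each with the same minor.\<close>
  have "per (?p # ?p # ?r (Suc (2 * n))) (insert m ?S)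
     = (\<Sum>i<Suc (2 * n). ?D m * per (?p # ?p # ?r (2 * n)) ?S)"
  proof -
    have fS: "finite ?S" "m \<notin> ?S" by auto
    have "per (?p # ?p # ?r (Suc (2 * n))) (insert m ?S)
      = (\<Sum>i<Suc (2 * n). (?r (Suc (2 * n)) ! i) m * per (?p # ?p # (take i (?r (Suc (2 * n))) @ drop (Suc i) (?r (Suc (2 * n))))) ?S)"
      unfolding per_row_expansion[OF fS] length_Cons length_replicate
      using Dm(1) by (subst sum.lessThan_Suc_shift, subst sum.lessThan_Suc_shift)
        (simp del: sum.lessThan_Suc per.simps replicate.simps)
    also have "\<dots> = (\<Sum>i<Suc (2 * n). ?D m * per (?p # ?p # ?r (2 * n)) ?S)"
      by (rule sum.cong) (simp_all only: del nth lessThan_iff)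
    finally show ?thesis .
  qed
  also have "\<dots> = real (Suc (2 * n)) * (?D m * per (?p # ?p # ?r (2 * n)) ?S)"
    by (simp only: sum_constant card_lessThan)
  finally show ?thesis unfolding S using P Dm(2) by (simp del: per.simps)
qed

section \<open>Edge lists with bounded multiplicities and nonzero permanent\<close>

definition bounded_choice :: "nat \<Rightarrow> 'v set \<Rightarrow> 'v set list \<Rightarrow> bool" where
  "bounded_choice k W es \<longleftrightarrow> set es \<subseteq> {e \<in> edges G. e \<subseteq> W} \<and>
     (\<forall>e. count_list es e \<le> k) \<and> per (map col es) (arcs_in W) \<noteq> 0"

text \<open>The edges added here all leave the remainder on which \<open>rs\<close> lives, so
  multiplicities from the two sources never accumulate. Since the selection from \<open>zs\<close>
  is not controlled, the bound counts every pair that contains \<open>e\<close>.\<close>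

lemma bounded_choice_step:
  assumes J: "J \<subseteq> isolated_edges (W - {u, v})"
    and T: "T = arcs_at W u \<union> arcs_at W v \<union> {(x, y) \<in> arcs_in (W - {u, v}). {x, y} \<in> J}"
    and cs: "cs = map col es @ map (\<lambda>(x, y) f. col x f - col y f) zs"
    and vanish: "\<forall>c\<in>set cs. \<forall>f\<in>arcs_in (W - {u, v}) - T. c f = 0"
    and nz: "per cs T \<noteq> 0"
    and phi: "\<forall>g\<in>isolated_edges (W - {u, v}) - J. \<phi> g \<in> edges G \<and> \<phi> g \<subseteq> W \<and>
      (\<exists>x a. \<phi> g = {x, a} \<and> x \<in> {u, v} \<and> a \<in> g)"
    and rs: "bounded_choice k (W - {u, v} - \<Union> (isolated_edges (W - {u, v}))) rs"
    and used: "\<forall>e\<in>set es \<union> fst ` set zs \<union> snd ` set zs. e \<in> edges G \<and> e \<subseteq> W \<and>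
      \<not> e \<subseteq> W - {u, v} - \<Union> (isolated_edges (W - {u, v}))"
    and count: "\<And>e. count_list es e + length (filter (\<lambda>(y, z). e = y \<or> e = z) zs)
      + of_bool (e \<in> \<phi> ` (isolated_edges (W - {u, v}) - J)) \<le> k"
  shows "\<exists>es. bounded_choice k W es"
proof -
  let ?I = "isolated_edges (W - {u, v})"
  let ?R = "W - {u, v} - \<Union> ?I"
  have "finite (?I - J)" using finite_isolated_edges by simp
  then obtain gs where gs: "distinct gs" "set gs = ?I - J" using finite_distinct_list by blast
  have phi': "\<forall>g\<in>set gs. \<exists>x a. \<phi> g = {x, a} \<and> x \<in> {u, v} \<and> a \<in> g"
    using phi unfolding gs(2) by blast
  have "per (map col rs) (arcs_in ?R) \<noteq> 0" using rs by (simp add: bounded_choice_def)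
  from per_step[OF J T cs vanish nz gs phi' this] obtain xs where
    xs: "list_all2 (\<lambda>x (y, z). x = y \<or> x = z) xs zs"
      "per (map col (es @ xs @ map \<phi> gs @ rs)) (arcs_in W) \<noteq> 0" by blast
  have rsE: "\<forall>e\<in>set rs. e \<in> edges G \<and> e \<subseteq> ?R" using rs unfolding bounded_choice_def by blast
  have phiR: "\<not> \<phi> g \<subseteq> ?R" if g: "g \<in> set gs" for g
  proof -
    obtain x a where "\<phi> g = {x, a}" "x \<in> {u, v}" using bspec[OF phi' g] by blast
    then show ?thesis by auto
  qed
  have xsE: "\<forall>e\<in>set xs. e \<in> edges G \<and> e \<subseteq> W \<and> \<not> e \<subseteq> ?R"
  proof
    fix e assume "e \<in> set xs"
    then have "e \<in> set es \<union> fst ` set zs \<union> snd ` set zs" using choice_set[OF xs(1)] by (simp add: subset_iff)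
    with used show "e \<in> edges G \<and> e \<subseteq> W \<and> \<not> e \<subseteq> ?R" by (rule bspec)
  qed
  have dist: "distinct (map \<phi> gs)"
    by (rule distinct_attached[OF gs(1) _ phi']) (use gs(2) in auto)
  have phic: "count_list (map \<phi> gs) e \<le> of_bool (e \<in> \<phi> ` (?I - J))" for e
  proof (cases "e \<in> \<phi> ` (?I - J)")
    case True
    then show ?thesis using count_list_distinct[OF dist, of e] by simp
  next
    case False
    then show ?thesis by (simp add: gs(2) count_list_0_iff)
  qed
  have "count_list (es @ xs @ map \<phi> gs @ rs) e \<le> k" for e
  proof (cases "e \<subseteq> ?R")
    case True
    have "e \<notin> set es" using used True by (meson UnI1)
    moreover have "e \<notin> set xs" using xsE True by blast
    moreover have "e \<notin> set (map \<phi> gs)" using phiR True by fastforce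
    ultimately have "count_list (es @ xs @ map \<phi> gs @ rs) e = count_list rs e"
      by (simp add: count_list_0_iff del: set_map)
    then show ?thesis using rs by (simp add: bounded_choice_def)
  next
    case False
    then have "e \<notin> set rs" using rsE by blast
    then have "count_list rs e = 0" by (simp add: count_list_0_iff)
    then show ?thesis
      using count_choice[OF xs(1), of e] phic[of e] count[of e] by simp
  qed
  moreover have "set (es @ xs @ map \<phi> gs @ rs) \<subseteq> {e \<in> edges G. e \<subseteq> W}"
  proof
    fix e assume "e \<in> set (es @ xs @ map \<phi> gs @ rs)"
    then consider "e \<in> set es" | "e \<in> set xs" | "e \<in> \<phi> ` (?I - J)" | "e \<in> set rs"
      using gs(2) by auto
    then show "e \<in> {e \<in> edges G. e \<subseteq> W}"
    proof cases
      case 1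
      then show ?thesis using used by simp
    next
      case 2
      then show ?thesis using xsE by simp
    next
      case 3
      then show ?thesis using phi by auto
    next
      case 4
      then show ?thesis using rsE by blast
    qed
  qed
  ultimately show ?thesis using xs(2) unfolding bounded_choice_def by blast
qed

text \<open>The pair \<open>u\<close>, \<open>v\<close> is at distance exactly 2 in the subgraph
  induced by \<open>W\<close>; the middle vertex \<open>w\<close> is recorded because its two edges
  form the difference column.\<close>

definition cherry :: "'v set \<Rightarrow> 'v \<Rightarrow> 'v \<Rightarrow> 'v \<Rightarrow> bool" where
  "cherry W u v w \<longleftrightarrow> u \<in> W \<and> v \<in> W \<and> w \<in> W \<and> u \<noteq> v \<and> {u, v} \<notin> edges G \<and>
     {u, w} \<in> edges G \<and> {v, w} \<in> edges G"

lemma bounded_choice_cherry: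
  assumes iso: "isolated_edges W = {}" and k: "2 \<le> k"
    and ch: "cherry W u v w" and deg: "degree (induced G W) u + degree (induced G W) v \<le> k"
    and rs: "bounded_choice k (W - {u, v} - \<Union> (isolated_edges (W - {u, v}))) rs"
  shows "\<exists>es. bounded_choice k W es"
proof -
  let ?R = "W - {u, v}" and ?I = "isolated_edges (W - {u, v})"
  let ?S = "arcs_at W u \<union> arcs_at W v"
  \<comment> \<open>The isolated edges whose only links to \<open>u\<close> and \<open>v\<close> are
    \<open>{u, w}\<close> and \<open>{v, w}\<close>. They are put into \<open>J\<close> and cleared
    together with the rows at \<open>u\<close> and \<open>v\<close>.\<close>
  let ?bad = "\<lambda>g. w \<in> g \<and> (\<forall>a\<in>g. a \<noteq> w \<longrightarrow> {u, a} \<notin> edges G \<and> {v, a} \<notin> edges G)"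
  define J where "J = {g \<in> ?I. ?bad g}"
  have uv: "u \<noteq> v" "{u, v} \<notin> edges G" and W: "u \<in> W" "v \<in> W" "w \<in> W"
    and w: "{u, w} \<in> edges G" "{v, w} \<in> edges G"
    using ch by (auto simp: cherry_def)
  have ne: "w \<noteq> u" "w \<noteq> v" using edge_neq w by blast+
  \<comment> \<open>The attaching edge has to avoid \<open>{u, w}\<close> and \<open>{v, w}\<close>,
    since the difference columns may already use one of these \<open>k\<close> times.\<close>
  have "\<exists>e. e \<in> edges G \<and> e \<subseteq> W \<and> (\<exists>x a. e = {x, a} \<and> x \<in> {u, v} \<and> a \<in> g) \<and>
      e \<noteq> {u, w} \<and> e \<noteq> {v, w}" if g: "g \<in> ?I - J" for g
  proof -
    have gI: "g \<in> ?I" and nb: "\<not> ?bad g" using g by (auto simp: J_def)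
    have gR: "g \<subseteq> ?R" by (rule isolated_edgesD(2)[OF gI])
    obtain x a where xa: "{x, a} \<in> edges G" "{x, a} \<subseteq> W" "x \<in> {u, v}" "a \<in> g" "a \<noteq> w"
    proof (cases "w \<in> g")
      case True
      then obtain a where "a \<in> g" "a \<noteq> w" "{u, a} \<in> edges G \<or> {v, a} \<in> edges G"
        using nb by blast
      then show ?thesis using that gR W by blast
    next
      case False
      then show ?thesis using isolated_edge_attached[OF iso gI] that by blast
    qed
    moreover have "a \<notin> {u, v}" using gR xa(4) by blast
    then have "{x, a} \<noteq> {u, w}" "{x, a} \<noteq> {v, w}" using xa(5) by (auto simp: doubleton_eq_iff)
    ultimately show ?thesis by blast
  qed
  then obtain \<phi> where phi: "\<forall>g\<in>?I - J. \<phi> g \<in> edges G \<and> \<phi> g \<subseteq> W \<and>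
      (\<exists>x a. \<phi> g = {x, a} \<and> x \<in> {u, v} \<and> a \<in> g) \<and> \<phi> g \<noteq> {u, w} \<and> \<phi> g \<noteq> {v, w}"
    by metis
  have phi1: "\<forall>g\<in>?I - J. \<phi> g \<in> edges G \<and> \<phi> g \<subseteq> W \<and>
      (\<exists>x a. \<phi> g = {x, a} \<and> x \<in> {u, v} \<and> a \<in> g)" using phi by blast
  have phi0: "{u, w} \<notin> \<phi> ` (?I - J)" "{v, w} \<notin> \<phi> ` (?I - J)" using phi by auto
  have D: "(\<lambda>f. col {u, w} f - col {v, w} f) = diff_col u v"
    by (rule col_diff_col) (use ne in auto)
  have D0: "diff_col u v f = 0" if "f \<in> arcs_in ?R" for f
    using that by (auto simp: diff_col_def arcs_in_def)
  have disj: "arcs_at W u \<inter> arcs_at W v = {}"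
    using arc_edge uv by (fastforce simp: arcs_at_def arcs_in_def insert_commute)
  have cS: "card ?S = degree (induced G W) u + degree (induced G W) v"
    by (subst card_Un_disjoint[OF _ _ disj]) (simp_all add: card_arcs_at)
  have used: "e \<in> edges G \<and> e \<subseteq> W \<and> \<not> e \<subseteq> ?R - \<Union> ?I" if "e = {u, w} \<or> e = {v, w}" for e
    using that w W by auto
  show ?thesis
  proof (cases "J = {}")
    case True
    let ?zs = "replicate (card ?S) ({u, w}, {v, w})"
    let ?cs = "replicate (card ?S) (diff_col u v)"
    show ?thesis
    proof (rule bounded_choice_step[where es = "[]" and zs = ?zs and cs = ?cs and T = ?S
          and \<phi> = \<phi>, OF _ _ _ _ _ phi1 rs])
      show "?cs = map col [] @ map (\<lambda>(x, y) f. col x f - col y f) ?zs" by (simp add: D)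
      show "per ?cs ?S \<noteq> 0" by (rule per_nonadjacent[OF uv refl])
      show "\<forall>e\<in>set [] \<union> fst ` set ?zs \<union> snd ` set ?zs. e \<in> edges G \<and> e \<subseteq> W \<and>
          \<not> e \<subseteq> ?R - \<Union> ?I" using used by auto
      show "count_list [] e + length (filter (\<lambda>(y, z). e = y \<or> e = z) ?zs)
          + of_bool (e \<in> \<phi> ` (?I - J)) \<le> k" for e
        using k deg cS phi0 by (cases "e = {u, w} \<or> e = {v, w}") (auto simp: filter_replicate)
    qed (use True D0 in auto)
  next
    case False
    then obtain g where g: "g \<in> ?I" "?bad g" by (auto simp: J_def)
    \<comment> \<open>All members of \<open>J\<close> contain \<open>w\<close>, so disjointness of
      isolated edges leaves only one.\<close>
    have "h = g" if "h \<in> J" for h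
    proof (rule isolated_edges_disjoint)
      show "h \<in> ?I" "w \<in> h" using that by (simp_all add: J_def)
    qed (use g in simp_all)
    moreover have "g \<in> J" using g unfolding J_def by blast
    ultimately have J: "J = {g}" by blast
    note gD = isolated_edgesD[OF g(1)]
    obtain p q where "g = {p, q}" "p \<noteq> q" using edge_card[OF gD(1)] by (auto simp: card_2_iff)
    then obtain b where b: "g = {w, b}" "b \<noteq> w" using g(2) by blast
    have wb: "{w, b} \<in> edges G" "b \<noteq> u" "b \<noteq> v" "b \<in> W" using gD(1,2) b by auto
    have b0: "{u, b} \<notin> edges G" "{v, b} \<notin> edges G" using g(2) b by auto
    obtain m where m: "m \<in> A" "m = (w, b) \<or> m = (b, w)" using edge_arc[OF wb(1)] by blast
    have ms: "{(x, y) \<in> arcs_in ?R. {x, y} \<in> J} = {m}"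
    proof (intro equalityI subsetI)
      fix f assume f: "f \<in> {(x, y) \<in> arcs_in ?R. {x, y} \<in> J}"
      obtain x y where xy: "f = (x, y)" by (cases f)
      have "(x, y) \<in> A" "{x, y} = {w, b}" using f by (auto simp: xy J b arcs_in_def)
      then show "f \<in> {m}"
        using arc_unique[of x y w b] arc_unique[of x y b w] m by (auto simp: xy insert_commute)
    next
      fix f assume "f \<in> {m}"
      then show "f \<in> {(x, y) \<in> arcs_in ?R. {x, y} \<in> J}"
        using m ne wb W by (auto simp: J b arcs_in_def insert_commute)
    qed
    have "arcs_at W u \<noteq> {}" "arcs_at W v \<noteq> {}"
      using edge_arc[OF w(1)] edge_arc[OF w(2)] W by (auto simp: arcs_at_def arcs_in_def)
    then have "card (arcs_at W u) \<noteq> 0" "card (arcs_at W v) \<noteq> 0" by auto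
    moreover have "card ?S = card (arcs_at W u) + card (arcs_at W v)"
      by (rule card_Un_disjoint) (use disj in auto)
    ultimately have "2 \<le> card ?S" by linarith
    then have "card ?S = Suc (Suc (card ?S - 2))" by linarith
    then obtain n where n: "card ?S = Suc (Suc n)" by blast
    \<comment> \<open>Here \<open>n\<close> is the degree sum minus 2, so \<open>{u, w}\<close> and
      \<open>{v, w}\<close> each occur at most \<open>n + 1\<close> times, which is still below
      \<open>k\<close>.\<close>
    let ?zs = "replicate n ({u, w}, {v, w})"
    let ?es = "[{w, b}, {u, w}, {v, w}]"
    let ?cs = "col {w, b} # col {u, w} # col {v, w} # replicate n (diff_col u v)"
    have c0: "col {w, b} f = 0 \<and> col {u, w} f = 0 \<and> col {v, w} f = 0"
      if f: "f \<in> arcs_in ?R" "f \<noteq> m" for f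
    proof -
      obtain x y where xy: "f = (x, y)" by (cases f)
      have fA: "(x, y) \<in> A" "x \<in> ?R" "y \<in> ?R" using f by (auto simp: xy arcs_in_def)
      have "{x, y} \<notin> J" using f ms by (auto simp: xy)
      then have "{x, y} \<noteq> g" using J by simp
      then have "c \<notin> g" if "c \<in> {x, y}" for c
        using gD(3)[of "{x, y}" c] arc_edge[OF fA(1)] fA(2,3) that by blast
      then show ?thesis using fA(2,3) b(1) by (auto simp: xy col_def)
    qed
    show ?thesis
    proof (rule bounded_choice_step[where es = ?es and zs = ?zs and cs = ?cs and T = "insert m ?S"
          and \<phi> = \<phi>, OF _ _ _ _ _ phi1 rs])
      show "J \<subseteq> ?I" by (auto simp: J_def)
      show "insert m ?S = ?S \<union> {(x, y) \<in> arcs_in ?R. {x, y} \<in> J}" unfolding ms by simp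
      show "?cs = map col ?es @ map (\<lambda>(x, y) f. col x f - col y f) ?zs" by (simp add: D)
      show "\<forall>c\<in>set ?cs. \<forall>f\<in>arcs_in ?R - insert m ?S. c f = 0"
        using c0 D0 by auto
      show "per ?cs (insert m ?S) \<noteq> 0"
        by (rule per_pendant[OF uv W wb(4) w wb(1-3) b0 n m])
      have "{w, b} \<in> edges G \<and> {w, b} \<subseteq> W \<and> \<not> {w, b} \<subseteq> ?R - \<Union> ?I"
        using wb W g(1) b by auto
      then show "\<forall>e\<in>set ?es \<union> fst ` set ?zs \<union> snd ` set ?zs. e \<in> edges G \<and> e \<subseteq> W \<and>
          \<not> e \<subseteq> ?R - \<Union> ?I" using used by auto
      have "{w, b} \<notin> \<phi> ` (?I - J)"
      proof
        assume "{w, b} \<in> \<phi> ` (?I - J)"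
        then obtain h where h: "h \<in> ?I - J" "\<phi> h = {w, b}" by (elim imageE) simp
        obtain x a where "\<phi> h = {x, a}" "x \<in> {u, v}" using bspec[OF phi1 h(1)] by blast
        then have "x \<in> {w, b}" "x \<in> {u, v}" using h(2) by simp_all
        then show False using ne wb(2,3) by auto
      qed
      moreover have "{w, b} \<noteq> {u, w}" "{w, b} \<noteq> {v, w}" "{u, w} \<noteq> {v, w}"
        using ne wb uv by (auto simp: doubleton_eq_iff)
      ultimately show "count_list ?es e + length (filter (\<lambda>(y, z). e = y \<or> e = z) ?zs)
          + of_bool (e \<in> \<phi> ` (?I - J)) \<le> k" for e
        using k deg cS n phi0
        by (cases "e = {u, w}"; cases "e = {v, w}"; cases "e = {w, b}") (auto simp: filter_replicate)
    qed
  qed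
qed

text \<open>Without cherries adjacency is transitive on distinct vertices of \<open>W\<close>, so
  \<open>u\<close> and \<open>v\<close> have the same further neighbours \<open>K\<close>. This
  gives them equal degrees, as \<open>per_adjacent\<close> requires.\<close>

lemma bounded_choice_adjacent:
  assumes iso: "isolated_edges W = {}" and k: "2 \<le> k" and fin: "finite W"
    and no: "\<And>x y z. \<not> cherry W x y z"
    and e: "{u, v} \<in> edges G" and W: "u \<in> W" "v \<in> W"
    and rs: "bounded_choice k (W - {u, v} - \<Union> (isolated_edges (W - {u, v}))) rs"
  shows "\<exists>es. bounded_choice k W es"
proof -
  let ?R = "W - {u, v}" and ?I = "isolated_edges (W - {u, v})"
  let ?S = "arcs_at W u \<union> arcs_at W v"
  have uv: "u \<noteq> v" by (rule edge_neq[OF e])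
  define K where "K = {x \<in> W. x \<noteq> u \<and> x \<noteq> v \<and> {u, x} \<in> edges G}"
  have tri: "{x, y} \<in> edges G" if xyz: "x \<in> W" "y \<in> W" "z \<in> W" "x \<noteq> y" "{x, z} \<in> edges G" "{y, z} \<in> edges G"
    for x y z using no[of x y z] xyz by (simp add: cherry_def)
  have Kv: "{u, x} \<in> edges G \<longleftrightarrow> {v, x} \<in> edges G" if x: "x \<in> W" "x \<noteq> u" "x \<noteq> v" for x
  proof
    assume "{u, x} \<in> edges G"
    then show "{v, x} \<in> edges G" using tri[of v x u] x W e by (auto simp: insert_commute)
  next
    assume "{v, x} \<in> edges G"
    then show "{u, x} \<in> edges G" using tri[of u x v] x W e by (auto simp: insert_commute)
  qed
  have finK: "finite K" using fin by (simp add: K_def)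
  have e': "{v, u} \<in> edges G" using e by (simp add: insert_commute)
  have uu: "{u, u} \<notin> edges G" "{v, v} \<notin> edges G" using edge_neq by blast+
  have Ne: "{x \<in> W. {u, x} \<in> edges G} = insert v K" "{x \<in> W. {v, x} \<in> edges G} = insert u K"
  proof -
    have "x \<in> W \<and> {u, x} \<in> edges G \<longleftrightarrow> x \<in> insert v K" for x
      using W e uu uv by (cases "x = u"; cases "x = v") (simp_all add: K_def)
    then show "{x \<in> W. {u, x} \<in> edges G} = insert v K" by blast
    have "x \<in> W \<and> {v, x} \<in> edges G \<longleftrightarrow> x \<in> insert u K" for x
      using W e' uu uv Kv[of x] by (cases "x = u"; cases "x = v"; cases "x \<in> W") (simp_all add: K_def)
    then show "{x \<in> W. {v, x} \<in> edges G} = insert u K" by blast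
  qed
  have notK: "u \<notin> K" "v \<notin> K" by (simp_all add: K_def)
  have "K \<noteq> {}"
  proof -
    have "{u, v} \<notin> isolated_edges W" using iso by simp
    then obtain e' a where e': "e' \<in> edges G" "e' \<subseteq> W" "a \<in> e'" "a \<in> {u, v}" "e' \<noteq> {u, v}"
      using e W unfolding isolated_edges_def by blast
    obtain p q where "e' = {p, q}" "p \<noteq> q" using edge_card[OF e'(1)] by (auto simp: card_2_iff)
    then obtain c where c: "e' = {a, c}" "a \<noteq> c" using e'(3) by blast
    have "c \<noteq> u" "c \<noteq> v" using c e'(4,5) by auto
    moreover have "{u, c} \<in> edges G" using Kv[of c] e' c calculation by auto
    ultimately show ?thesis using c e'(2) by (auto simp: K_def)
  qed
  then obtain k0 where k0: "k0 \<in> K" by blast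
  obtain ks where ks: "distinct ks" "set ks = K - {k0}"
    using finite_distinct_list[of "K - {k0}"] finK by auto
  \<comment> \<open>All common neighbours are listed twice except \<open>k0\<close>, listed once:
    this gives the odd number of difference columns and keeps one further use of
    \<open>{u, k0}\<close> free.\<close>
  let ?js = "k0 # concat (map (\<lambda>x. [x, x]) ks)"
  define n where "n = length ks"
  have js_set: "set ?js = K" using ks(2) k0 by auto
  have js_len: "length ?js = Suc (2 * n)" by (simp add: n_def length_concat comp_def sum_list_triv)
  have js_count: "count_list ?js x \<le> (if x = k0 then 1 else 2)" for x
  proof -
    have "count_list (concat (map (\<lambda>x. [x, x]) ys)) x = 2 * count_list ys x" for ys
      by (induction ys) auto
    moreover have "count_list ks x \<le> (if x = k0 then 0 else 1)"
      using count_list_distinct[OF ks(1), of x] ks(2) by (auto simp: count_list_0_iff)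
    ultimately show ?thesis by (auto split: if_splits)
  qed
  have "card K = Suc n"
  proof -
    have "card (set ks) = n" using ks(1) by (simp add: n_def distinct_card)
    then show ?thesis using ks(2) k0 finK by (metis card.remove)
  qed
  then have cards: "card (arcs_at W u) = Suc (Suc n)" "card (arcs_at W v) = Suc (Suc n)"
    using finK notK by (simp_all add: card_arcs_at degree_induced W Ne)
  obtain m where m: "m \<in> A" "m = (u, v) \<or> m = (v, u)" using edge_arc[OF e] by blast
  let ?zs = "map (\<lambda>x. ({u, x}, {v, x})) ?js"
  let ?cs = "col {u, v} # col {u, v} # replicate (Suc (2 * n)) (diff_col u v)"
  have D: "(\<lambda>f. col {u, x} f - col {v, x} f) = diff_col u v" if "x \<in> K" for x
    by (rule col_diff_col) (use that notK in auto)
  have D0: "diff_col u v f = 0 \<and> col {u, v} f = 0" if "f \<in> arcs_in ?R" for f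
    using that by (auto simp: diff_col_def col_def arcs_in_def)
  \<comment> \<open>An end \<open>a\<close> of \<open>g\<close> is adjacent to \<open>u\<close>, so
    it equals \<open>k0\<close> or is adjacent to \<open>k0\<close>, and then \<open>g\<close> is
    \<open>{a, k0}\<close>. Hence at most one isolated edge arises and the constant map to
    \<open>{u, k0}\<close> can attach it.\<close>
  have Ik0: "k0 \<in> g" if g: "g \<in> ?I" for g
  proof -
    note gD = isolated_edgesD[OF g]
    obtain x a where xa: "{x, a} \<in> edges G" "{x, a} \<subseteq> W" "x \<in> {u, v}" "a \<in> g"
      using isolated_edge_attached[OF iso g] by blast
    have a: "a \<in> W" "a \<noteq> u" "a \<noteq> v" using gD(2) xa(4) by auto
    then have "{u, a} \<in> edges G" using xa(1,3) Kv[of a] by auto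
    show ?thesis
    proof (cases "a = k0")
      case False
      have "{a, k0} \<in> edges G"
        using tri[of a k0 u] a W k0 False \<open>{u, a} \<in> edges G\<close> by (auto simp: K_def insert_commute)
      then have "{a, k0} = g" using gD(3)[of "{a, k0}" a] a xa(4) k0 by (auto simp: K_def)
      then show ?thesis by auto
    qed (use xa in simp)
  qed
  have k0e: "{u, k0} \<in> edges G" "k0 \<in> W" using k0 by (simp_all add: K_def)
  show ?thesis
  proof (rule bounded_choice_step[where J = "{}" and es = "[{u, v}, {u, v}]" and zs = ?zs and cs = ?cs
        and T = ?S and \<phi> = "\<lambda>_. {u, k0}", OF _ _ _ _ _ _ rs])
    have "map (\<lambda>(x, y) f. col x f - col y f) ?zs = map (\<lambda>_. diff_col u v) ?js"
      using D js_set by (auto simp del: set_concat)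
    also have "\<dots> = replicate (Suc (2 * n)) (diff_col u v)"
      by (simp only: map_replicate_const js_len)
    finally show "?cs = map col [{u, v}, {u, v}] @ map (\<lambda>(x, y) f. col x f - col y f) ?zs"
      by simp
    show "per ?cs ?S \<noteq> 0" by (rule per_adjacent[OF uv m W cards])
    show "\<forall>g\<in>?I - {}. {u, k0} \<in> edges G \<and> {u, k0} \<subseteq> W \<and>
        (\<exists>x a. {u, k0} = {x, a} \<and> x \<in> {u, v} \<and> a \<in> g)"
      using k0e W Ik0 by blast
    have zsK: "set ?zs = (\<lambda>x. ({u, x}, {v, x})) ` K" by (simp only: set_map js_set)
    have Ke: "{u, x} \<in> edges G \<and> {v, x} \<in> edges G \<and> x \<in> W" if "x \<in> K" for x
      using that Kv[of x] by (simp add: K_def)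
    show "\<forall>e\<in>set [{u, v}, {u, v}] \<union> fst ` set ?zs \<union> snd ` set ?zs. e \<in> edges G \<and> e \<subseteq> W \<and>
        \<not> e \<subseteq> ?R - \<Union> ?I"
      unfolding zsK image_image fst_conv snd_conv using e W Ke by auto
    \<comment> \<open>No edge exceeds 2: \<open>{u, v}\<close> occurs twice, an edge to
      \<open>x\<close> other than \<open>k0\<close> lies in two pairs, and an edge to
      \<open>k0\<close> lies in one pair and may serve once more for attaching.\<close>
    show "count_list [{u, v}, {u, v}] e + length (filter (\<lambda>(y, z). e = y \<or> e = z) ?zs)
        + of_bool (e \<in> (\<lambda>_. {u, k0}) ` (?I - {})) \<le> k" for e
    proof -
      let ?Q = "\<lambda>x. e = {u, x} \<or> e = {v, x}"
      have len: "length (filter (\<lambda>(y, z). e = y \<or> e = z) ?zs) = length (filter ?Q ?js)"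
        by (simp only: filter_map length_map comp_def prod.case)
      show ?thesis
      proof (cases "\<exists>x\<in>K. ?Q x")
        case True
        then obtain x where x: "x \<in> K" "?Q x" by blast
        have "x \<noteq> u" "x \<noteq> v" using x notK by auto
        then have neuv: "e \<noteq> {u, v}" and k0x: "e = {u, k0} \<Longrightarrow> x = k0" using x(2) by auto
        have "filter ?Q ?js = filter ((=) x) ?js"
        proof (rule filter_cong[OF refl])
          fix y assume "y \<in> set ?js"
          then have "y \<noteq> u" "y \<noteq> v" using js_set notK by auto
          then show "?Q y = (x = y)" using x(2) \<open>x \<noteq> u\<close> \<open>x \<noteq> v\<close> by (auto simp: doubleton_eq_iff)
        qed
        then have "length (filter ?Q ?js) = count_list ?js x"
          by (simp only: count_list_eq_length_filter)
        then have c: "length (filter (\<lambda>(y, z). e = y \<or> e = z) ?zs) = count_list ?js x"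
          unfolding len .
        have c0: "count_list [{u, v}, {u, v}] e = 0" using neuv by simp
        show ?thesis
        proof (cases "x = k0")
          case True
          have "count_list ?js x \<le> 1" using js_count[of x] unfolding if_P[OF True] .
          moreover have "of_bool (e \<in> (\<lambda>_. {u, k0}) ` (?I - {})) \<le> (1 :: nat)" by simp
          ultimately show ?thesis using c c0 k by linarith
        next
          case False
          have "count_list ?js x \<le> 2" using js_count[of x] unfolding if_not_P[OF False] .
          moreover have "of_bool (e \<in> (\<lambda>_. {u, k0}) ` (?I - {})) = (0 :: nat)"
            using False k0x by auto
          ultimately show ?thesis using c c0 k by linarith
        qed
      next
        case False
        then have "\<forall>x\<in>set ?js. \<not> ?Q x" unfolding js_set by blast
        then have "filter ?Q ?js = []" by (simp only: filter_empty_conv simp_thms)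
        then have "length (filter (\<lambda>(y, z). e = y \<or> e = z) ?zs) = 0" unfolding len by (simp only: list.size)
        moreover have "of_bool (e \<in> (\<lambda>_. {u, k0}) ` (?I - {})) = (0 :: nat)" using False k0 by auto
        moreover have "count_list [{u, v}, {u, v}] e \<le> 2" by simp
        ultimately show ?thesis using k by linarith
      qed
    qed
  qed (use D0 in auto)
qed

text \<open>Strong induction on \<open>card W\<close>: delete a cherry pair of small degree sum or,
  without cherries, the ends of any edge, and then discard the isolated edges created. The degree
  condition speaks of all subsets of \<open>W\<close> and is therefore inherited.\<close>

lemma bounded_choice_exists:
  assumes "finite W" "isolated_edges W = {}" "2 \<le> k"
    and "\<And>X x y z. X \<subseteq> W \<Longrightarrow> cherry X x y z \<Longrightarrow> \<exists>u v w. cherry X u v w \<and>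
      degree (induced G X) u + degree (induced G X) v \<le> k"
  shows "\<exists>es. bounded_choice k W es"
  using assms(1,2,4)
proof (induction "card W" arbitrary: W rule: less_induct)
  case less
  have IH: "\<exists>es. bounded_choice k (W - {u, v} - \<Union> (isolated_edges (W - {u, v}))) es"
    if u: "u \<in> W" for u v
  proof (rule less.hyps)
    show "card (W - {u, v} - \<Union> (isolated_edges (W - {u, v}))) < card W"
      by (rule psubset_card_mono) (use less.prems(1) u in auto)
    show "isolated_edges (W - {u, v} - \<Union> (isolated_edges (W - {u, v}))) = {}"
      by (rule isolated_edges_remainder)
    show "\<exists>u v w. cherry X u v w \<and> degree (induced G X) u + degree (induced G X) v \<le> k"
      if X: "X \<subseteq> W - {u, v} - \<Union> (isolated_edges (W - {u, v}))" "cherry X x y z" for X x y z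
      by (rule less.prems(3)[OF _ X(2)]) (use X(1) in blast)
  qed (use less.prems(1) in simp)
  consider (cherry) x y z where "cherry W x y z"
    | (adjacent) u v where "\<And>x y z. \<not> cherry W x y z" "{u, v} \<in> edges G" "u \<in> W" "v \<in> W"
    | (empty) "arcs_in W = {}"
    using arc_edge by (fastforce simp: arcs_in_def)
  then show ?case
  proof cases
    case cherry
    then obtain u v w where u: "cherry W u v w" "degree (induced G W) u + degree (induced G W) v \<le> k"
      using less.prems(3)[of W] by blast
    then have "u \<in> W" by (simp add: cherry_def)
    from IH[OF this, of v] obtain rs
      where "bounded_choice k (W - {u, v} - \<Union> (isolated_edges (W - {u, v}))) rs" by blast
    then show ?thesis by (rule bounded_choice_cherry[OF less.prems(2) assms(3) u])
  next
    case adjacent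
    from IH[OF adjacent(3), of v] obtain rs
      where "bounded_choice k (W - {u, v} - \<Union> (isolated_edges (W - {u, v}))) rs" by blast
    then show ?thesis
      by (rule bounded_choice_adjacent[OF less.prems(2) assms(3) less.prems(1) adjacent])
  next
    case empty
    then have "bounded_choice k W []" by (simp add: bounded_choice_def)
    then show ?thesis by blast
  qed
qed

end


subsection \<open>Degeneracy and monomial index\<close>

lemma adj_power_2: "(u, v) \<in> adj H ^^ 2 \<longleftrightarrow> (\<exists>w. {u, w} \<in> edges H \<and> {w, v} \<in> edges H)"
  by (auto simp: adj_def numeral_2_eq_2)

text \<open>A finite infimum of walk lengths is attained, so distance 2 means that a walk of length
  2 exists and that lengths 0 and 1 are impossible.\<close>

lemma distance_eq_2_iff:
  "distance H u v = 2 \<longleftrightarrow>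
    u \<noteq> v \<and> {u, v} \<notin> edges H \<and> (\<exists>w. {u, w} \<in> edges H \<and> {w, v} \<in> edges H)"
proof -
  let ?S = "{enat n | n. (u, v) \<in> adj H ^^ n}"
  have le: "distance H u v \<le> enat n" if "(u, v) \<in> adj H ^^ n" for n
    unfolding distance_def by (rule Inf_lower) (use that in blast)
  have attained: "(u, v) \<in> adj H ^^ n" if n: "distance H u v = enat n" for n
  proof -
    have "?S \<noteq> {}"
    proof
      assume "?S = {}"
      then have "distance H u v = \<infinity>" unfolding distance_def by (simp add: Inf_enat_def)
      then show False using n by simp
    qed
    then have "distance H u v \<in> ?S" unfolding distance_def by (meson equals0I wellorder_InfI)
    then show ?thesis using n by auto
  qed
  have two: "(2::enat) = enat 2" by (simp add: numeral_eq_enat)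
  show ?thesis
  proof
    assume d: "distance H u v = 2"
    have "(u, v) \<notin> adj H ^^ 0" "(u, v) \<notin> adj H ^^ 1"
      using le[of 0] le[of 1] d unfolding two by auto
    then have "u \<noteq> v" "{u, v} \<notin> edges H" by (auto simp: adj_def)
    moreover have "(u, v) \<in> adj H ^^ 2" using attained[of 2] d by (simp add: two)
    ultimately show "u \<noteq> v \<and> {u, v} \<notin> edges H \<and> (\<exists>w. {u, w} \<in> edges H \<and> {w, v} \<in> edges H)"
      by (simp add: adj_power_2)
  next
    assume h: "u \<noteq> v \<and> {u, v} \<notin> edges H \<and> (\<exists>w. {u, w} \<in> edges H \<and> {w, v} \<in> edges H)"
    then have "distance H u v \<le> enat 2" using le[of 2] by (simp add: adj_power_2)
    then obtain n where n: "distance H u v = enat n" "n \<le> 2"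
      by (metis enat_ile enat_ord_simps(1))
    have "n \<noteq> 0" using attained[OF n(1)] h by (intro notI) simp
    moreover have "n \<noteq> 1" using attained[OF n(1)] h by (intro notI) (simp add: adj_def)
    ultimately have "n = 2" using n(2) by linarith
    then show "distance H u v = 2" using n(1) by (simp add: two)
  qed
qed

section \<open>Degeneracy and niceness in terms of cherries and isolated edges\<close>

context oriented_graph
begin

lemma dist2_pairs_induced:
  "(u, v) \<in> dist2_pairs (induced G X) \<longleftrightarrow> (\<exists>w. cherry X u v w)"
  unfolding dist2_pairs_def distance_eq_2_iff cherry_def
  by (auto simp: induced_def insert_commute)

lemma degree_pos:
  assumes "{u, w} \<in> edges G" "u \<in> X" "w \<in> X"
  shows "1 \<le> degree (induced G X) u"
proof -
  have "finite {e \<in> edges (induced G X). u \<in> e}"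
    using finite_edges by (rule rev_finite_subset) (auto simp: induced_def)
  moreover have "{u, w} \<in> {e \<in> edges (induced G X). u \<in> e}" using assms by (simp add: induced_def)
  ultimately show ?thesis unfolding degree_def by (metis One_nat_def Suc_leI card_gt_0_iff empty_iff)
qed

lemma finite_verts: "finite (verts G)"
  using simple by (simp add: simple_graph_def)

lemma finite_pair_degrees:
  assumes "X \<subseteq> verts G"
  shows "finite {degree (induced G X) u + degree (induced G X) v | u v. (u, v) \<in> dist2_pairs (induced G X)}"
proof (rule finite_subset)
  show "{degree (induced G X) u + degree (induced G X) v | u v. (u, v) \<in> dist2_pairs (induced G X)}
      \<subseteq> (\<lambda>(u, v). degree (induced G X) u + degree (induced G X) v) ` (X \<times> X)"
    by (auto simp: dist2_pairs_def induced_def)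
  show "finite ((\<lambda>(u, v). degree (induced G X) u + degree (induced G X) v) ` (X \<times> X))"
    using finite_subset[OF assms finite_verts] by simp
qed

lemma delta2_attained:
  assumes "X \<subseteq> verts G" "dist2_pairs (induced G X) \<noteq> {}"
  obtains u v where "(u, v) \<in> dist2_pairs (induced G X)"
    "degree (induced G X) u + degree (induced G X) v = delta2 (induced G X)"
proof -
  let ?A = "{degree (induced G X) u + degree (induced G X) v | u v. (u, v) \<in> dist2_pairs (induced G X)}"
  have "?A \<noteq> {}" using assms(2) by auto
  then have "delta2 (induced G X) \<in> ?A"
    unfolding delta2_def by (rule Min_in[OF finite_pair_degrees[OF assms(1)]])
  then obtain u v where "(u, v) \<in> dist2_pairs (induced G X)"
    "delta2 (induced G X) = degree (induced G X) u + degree (induced G X) v" by blast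
  then show ?thesis using that by simp
qed

lemma delta2_le_degeneracy2:
  assumes "X \<subseteq> verts G" "dist2_pairs (induced G X) \<noteq> {}"
  shows "delta2 (induced G X) \<le> degeneracy2 G"
proof -
  let ?A = "{delta2 (induced G W) | W. W \<subseteq> verts G \<and> dist2_pairs (induced G W) \<noteq> {}}"
  have "finite ?A"
  proof (rule finite_subset)
    show "?A \<subseteq> (\<lambda>W. delta2 (induced G W)) ` Pow (verts G)" by auto
  qed (simp add: finite_verts)
  moreover have "delta2 (induced G X) \<in> ?A" using assms by blast
  ultimately have "delta2 (induced G X) \<le> Max ?A" by (rule Max_ge)
  moreover have "degeneracy2 G = Max ?A"
    unfolding degeneracy2_def using assms by (intro if_P) blast
  ultimately show ?thesis by simp
qed

text \<open>A pair attaining the minimum in \<open>delta2\<close> serves, as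
  \<open>degeneracy2\<close> is the maximum of these minima.\<close>

lemma cherry_degeneracy2:
  assumes X: "X \<subseteq> verts G" and ch: "cherry X x y z"
  shows "\<exists>u v w. cherry X u v w \<and>
    degree (induced G X) u + degree (induced G X) v \<le> degeneracy2 G"
proof -
  have ne: "dist2_pairs (induced G X) \<noteq> {}" using dist2_pairs_induced ch by blast
  obtain u v where uv: "(u, v) \<in> dist2_pairs (induced G X)"
    "degree (induced G X) u + degree (induced G X) v = delta2 (induced G X)"
    by (rule delta2_attained[OF X ne])
  then obtain w where "cherry X u v w" using dist2_pairs_induced by blast
  then show ?thesis using uv(2) delta2_le_degeneracy2[OF X ne] by (intro exI conjI) auto
qed

text \<open>Both outer vertices of a cherry have degree at least 1; if there is no cherry, the
  convention gives twice a positive maximum degree.\<close>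

lemma degeneracy2_ge_2:
  assumes "edges G \<noteq> {}"
  shows "2 \<le> degeneracy2 G"
proof (cases "\<exists>W\<subseteq>verts G. dist2_pairs (induced G W) \<noteq> {}")
  case True
  then obtain W where W: "W \<subseteq> verts G" "dist2_pairs (induced G W) \<noteq> {}" by blast
  then obtain x y z where "cherry W x y z" using dist2_pairs_induced by fastforce
  then obtain u v w where u: "cherry W u v w"
    "degree (induced G W) u + degree (induced G W) v \<le> degeneracy2 G"
    using cherry_degeneracy2[OF W(1)] by blast
  then have "1 \<le> degree (induced G W) u" "1 \<le> degree (induced G W) v"
    using degree_pos[of u w W] degree_pos[of v w W] by (simp_all add: cherry_def)
  then show ?thesis using u(2) by linarith
next
  case False
  obtain e where e: "e \<in> edges G" using assms by blast
  obtain a b where ab: "e = {a, b}" using edge_card[OF e] by (auto simp: card_2_iff)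
  have V: "a \<in> verts G" "b \<in> verts G" using simple e ab by (auto simp: simple_graph_def)
  have "induced G (verts G) = \<lparr>verts = verts G, edges = edges G\<rparr>"
    using simple by (auto simp: induced_def simple_graph_def)
  then have "1 \<le> degree G a" using degree_pos[of a b "verts G"] e ab V by (simp add: degree_def)
  also have "degree G a \<le> max_degree G"
    unfolding max_degree_def using finite_verts V(1) by (intro Max_ge) auto
  finally show ?thesis unfolding degeneracy2_def using False by (simp only: if_False)
qed

text \<open>The vertices reachable from one end of an isolated edge are just its two ends, so its
  component would be a copy of K_2.\<close>

lemma nice_no_isolated_edges:
  assumes "nice G"
  shows "isolated_edges (verts G) = {}"
proof (rule ccontr)
  assume "isolated_edges (verts G) \<noteq> {}"
  then obtain e where e: "e \<in> isolated_edges (verts G)" by blast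
  note eD = isolated_edgesD[OF e]
  obtain a b where ab: "e = {a, b}" "a \<noteq> b" using edge_card[OF eD(1)] by (auto simp: card_2_iff)
  have V: "a \<in> verts G" "b \<in> verts G" using eD(2) ab by auto
  have sub: "e' \<subseteq> verts G" if "e' \<in> edges G" for e'
    using simple that by (simp add: simple_graph_def)
  have step: "y \<in> {a, b}" if "x \<in> {a, b}" "(x, y) \<in> adj G" for x y
  proof -
    have "{x, y} \<in> edges G" using that(2) by (simp add: adj_def)
    then have "{x, y} = e" using eD(3)[of "{x, y}" x] sub that(1) ab by auto
    then show ?thesis using ab by auto
  qed
  have "(adj G)\<^sup>* `` {a} = {a, b}"
  proof (intro equalityI subsetI)
    fix y assume "y \<in> (adj G)\<^sup>* `` {a}"
    then have "(a, y) \<in> (adj G)\<^sup>*" by simp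
    then show "y \<in> {a, b}" by (induction rule: rtrancl_induct) (use step in auto)
  next
    fix y assume "y \<in> {a, b}"
    moreover have "(a, b) \<in> adj G" using eD(1) ab by (simp add: adj_def)
    ultimately show "y \<in> (adj G)\<^sup>* `` {a}" by auto
  qed
  then have comp: "induced G {a, b} \<in> components G"
    using V(1) unfolding components_def by (auto intro!: exI[of _ a])
  have "isomorphic (induced G {a, b}) (complete_graph 2)"
  proof -
    let ?f = "\<lambda>x. if x = a then 0 else 1 :: nat"
    have two: "{..<2} = {0, 1 :: nat}" by auto
    have "bij_betw ?f {a, b} {0, 1}" using ab(2) by (auto simp: bij_betw_def inj_on_def)
    moreover have "{x, y} \<in> edges (induced G {a, b}) \<longleftrightarrow> {?f x, ?f y} \<in> edges (complete_graph 2)"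
      if xy: "x \<in> {a, b}" "y \<in> {a, b}" for x y
    proof (cases "x = y")
      case True
      then have "{x, y} \<notin> edges (induced G {a, b})" using edge_neq[of x y] unfolding induced_def by auto
      then show ?thesis using True by (simp add: complete_graph_def)
    next
      case False
      then have "{x, y} = {a, b}" using xy by auto
      then have "{x, y} \<in> edges (induced G {a, b})" using eD(1) ab(1) by (auto simp: induced_def)
      moreover have "?f x \<noteq> ?f y" "{?f x, ?f y} \<subseteq> {..<2}" using False xy by auto
      then have "{?f x, ?f y} \<in> edges (complete_graph 2)"
        unfolding complete_graph_def by (simp add: card_insert_if)
      ultimately show ?thesis by simp
    qed
    ultimately show ?thesis unfolding isomorphic_def two[symmetric]
      by (intro exI[of _ ?f]) (simp add: induced_def complete_graph_def two)
  qed
  then show False using assms comp unfolding nice_def by blast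
qed

section \<open>From edge lists to the monomial index and to choosability\<close>

lemma vertex_poly_diff:
  "vertex_poly G y - vertex_poly G x =
    (\<Sum>e\<in>edges G. Poly_Mapping.single (Poly_Mapping.single e 1) (col e (x, y)))"
proof -
  have "vertex_poly G z = (\<Sum>e\<in>edges G. Poly_Mapping.single (Poly_Mapping.single e 1) (of_bool (z \<in> e)))" for z
    unfolding vertex_poly_def var_def
    by (rule sum.mono_neutral_cong_left) (use finite_edges in auto)
  then show ?thesis by (simp add: col_def single_diff sum_subtractf)
qed

lemma weight_diff:
  "(\<Sum>e\<in>{e \<in> edges G. y \<in> e}. w e) - (\<Sum>e\<in>{e \<in> edges G. x \<in> e}. w e)
    = (\<Sum>e\<in>edges G. col e (x, y) * w e)" for w :: "'v set \<Rightarrow> real"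
proof -
  have "(\<Sum>e\<in>{e \<in> edges G. z \<in> e}. w e) = (\<Sum>e\<in>edges G. of_bool (z \<in> e) * w e)" for z
    by (rule sum.mono_neutral_cong_left) (use finite_edges in auto)
  then show ?thesis by (simp add: col_def left_diff_distrib sum_subtractf)
qed

lemma mind_le:
  assumes "bounded_choice k (verts G) es"
  shows "mind (orientation_poly G A) \<le> enat k"
proof -
  have V: "arcs_in (verts G) = A"
    using arc_edge simple by (fastforce simp: arcs_in_def simple_graph_def)
  have es: "set es \<subseteq> edges G" "\<And>e. count_list es e \<le> k" "per (map col es) A \<noteq> 0"
    using assms by (auto simp: bounded_choice_def V)
  have P: "orientation_poly G A =
      (\<Prod>f\<in>A. \<Sum>e\<in>edges G. Poly_Mapping.single (Poly_Mapping.single e 1) (col e f))"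
    unfolding orientation_poly_def by (rule prod.cong) (auto simp: vertex_poly_diff)
  have "monomial (mset es) \<in> Poly_Mapping.keys (orientation_poly G A)"
    unfolding P in_keys_iff by (rule per_nonzero_coefficient[OF finite_arcs finite_edges es(1,3)])
  then have "mind (orientation_poly G A) \<le> enat (max_exponent (monomial (mset es)))"
    unfolding mind_def by (rule INF_lower)
  also have "max_exponent (monomial (mset es)) \<le> k"
  proof -
    \<comment> \<open>The exponents are the multiplicities in \<open>es\<close>; being bounded, they
      form a finite set, so \<open>Max\<close> is meaningful.\<close>
    have "range (Poly_Mapping.lookup (monomial (mset es))) \<subseteq> {..k}"
      using es(2) by (auto simp: count_mset)
    then show ?thesis
      unfolding max_exponent_def using finite_subset by (subst Max_le_iff) auto
  qed
  finally show ?thesis by simp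
qed

text \<open>Lists of size \<open>k + 1\<close> exceed every multiplicity in \<open>es\<close>, so
  the Nullstellensatz yields weights for which every arc has a nonzero difference of vertex
  sums.\<close>

lemma edge_weight_choosable_Suc:
  assumes "bounded_choice k (verts G) es"
  shows "edge_weight_choosable G (k + 1)"
  unfolding edge_weight_choosable_def
proof (intro allI impI)
  fix L :: "'v set \<Rightarrow> real set"
  assume L: "\<forall>e\<in>edges G. finite (L e) \<and> card (L e) = k + 1"
  have V: "arcs_in (verts G) = A"
    using arc_edge simple by (fastforce simp: arcs_in_def simple_graph_def)
  have es: "set es \<subseteq> edges G" "\<And>e. count_list es e \<le> k" "per (map col es) A \<noteq> 0"
    using assms by (auto simp: bounded_choice_def V)
  have "count (mset es) e < card (L e)" if "e \<in> edges G" for e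
    using es(2)[of e] L that by (simp add: count_mset)
  then obtain w where w: "\<forall>e\<in>edges G. w e \<in> L e" "\<forall>f\<in>A. (\<Sum>e\<in>edges G. col e f * w e) \<noteq> 0"
    using per_nonzero_grid[OF finite_arcs finite_edges es(1,3), of L] by blast
  have "(\<Sum>e\<in>{e \<in> edges G. u \<in> e}. w e) \<noteq> (\<Sum>e\<in>{e \<in> edges G. v \<in> e}. w e)"
    if "{u, v} \<in> edges G" for u v
    using edge_arc[OF that] w(2) weight_diff[of w u v] weight_diff[of w v u] by auto
  then show "\<exists>w. (\<forall>e\<in>edges G. w e \<in> L e) \<and> (\<forall>u v. {u, v} \<in> edges G \<longrightarrow>
      (\<Sum>e\<in>{e \<in> edges G. u \<in> e}. w e) \<noteq> (\<Sum>e\<in>{e \<in> edges G. v \<in> e}. w e))"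
    using w(1) by blast
qed

lemma bounded_choice_degeneracy2:
  assumes "nice G"
  shows "\<exists>es. bounded_choice (degeneracy2 G) (verts G) es"
\<comment> \<open>The induction needs a bound of at least 2, which \<open>degeneracy2_ge_2\<close>
  provides when there is an edge; for an edgeless graph the empty list works.\<close>
proof (cases "edges G = {}")
  case True
  then have "arcs_in (verts G) = {}" using arc_edge by (auto simp: arcs_in_def)
  then have "bounded_choice (degeneracy2 G) (verts G) []" by (simp add: bounded_choice_def)
  then show ?thesis by blast
next
  case False
  show ?thesis
    by (rule bounded_choice_exists[OF finite_verts nice_no_isolated_edges[OF assms]
          degeneracy2_ge_2[OF False] cherry_degeneracy2])
qed

end

theorem theorem4p1:
  fixes G :: "'v ugraph"
  assumes "simple_graph G" and "nice G" and "card (verts G) \<ge> 3"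
  shows "graph_mind G \<le> enat (degeneracy2 G) \<and>
         ch_edge_sum G \<le> enat (degeneracy2 G + 1)"
proof -
  obtain D where D: "orientation G D" using orientation_exists[OF assms(1)] by blast
  interpret oriented_graph G D using assms(1) D by unfold_locales
  obtain es where es: "bounded_choice (degeneracy2 G) (verts G) es"
    using bounded_choice_degeneracy2[OF assms(2)] by blast
  have "ch_edge_sum G \<le> enat (degeneracy2 G + 1)"
    unfolding ch_edge_sum_def using edge_weight_choosable_Suc[OF es] by (intro INF_lower) simp
  then show ?thesis using mind_le[OF es] graph_mind_eq[OF D] by simp
qed

end
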